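(* Let $0<\epsilon\ll1\ll R<\infty$ be properly chosen constants ($\epsilon$ sufficiently small, $R$ sufficiently large). There are constants $C,c>0$ such that the elements of $\hat G_e(t,k)$ have the following upper bounds (entrywise) for $t\ge0$. For $|k|<\epsilon$, $$|\hat G_e(t,k)|\le C\begin{pmatrix}|k|^2I_1&|k|^2I_1&|k|I_1\\ |k|^2I_1&|k|^2I_1&|k|I_1\\ |k|I_1&|k|I_1&I_1\end{pmatrix}e^{-\frac{k^2t}2}+C\begin{pmatrix}I_1&I_1&|k|I_1\\ I_1&I_1&|k|I_1\\ |k|I_1&|k|I_1&|k|^2I_1\end{pmatrix}e^{-\frac t8}.$$ For $|k|>R$, $$|\hat G_e(t,k)|\le C\begin{pmatrix}I_1&|k|^{-2}I_1&|k|^{-1}I_1\\ |k|^{-2}I_1&|k|^{-4}I_1&|k|^{-3}I_1\\ |k|^{-1}I_1&|k|^{-3}I_1&|k|^{-2}I_1\end{pmatrix}e^{-\frac t2}+C\begin{pmatrix}|k|^{-2}I_1&|k|^{-1}I_1&|k|^{-1}I_1\\ |k|^{-1}I_1&I_1&I_1\\ |k|^{-1}I_1&I_1&I_1\end{pmatrix}e^{-\frac t{4k^2}}.$$ For $\epsilon\le|k|\le R$, $$|\hat G_e(t,k)|\le C\begin{pmatrix}I_1&I_1&I_1\\ I_1&I_1&I_1\\ I_1&I_1&I_1\end{pmatrix}e^{-ct}.$$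
   Context: $\hat G_e(t,k)=e^{-t\hat A_r}$, $k\in\mathbb{R}$, is the $6\times6$ Fourier-space Green's function (fundamental matrix) of $\partial_t\hat U_r=-\hat A_r\hat U_r$, where $\hat U_r=(\hat u_r,\hat E_r,\hat B_r)^T$ with each component in $\mathbb{C}^2$ and $$\hat A_r=\begin{pmatrix}\mathbb{I}_2-\mathbb{O}_1&\mathbb{I}_2&0\\ -\mathbb{I}_2&0&-ik\mathbb{O}_1\\ 0&ik\mathbb{O}_1&0\end{pmatrix},\qquad \mathbb{O}_1=\begin{pmatrix}0&-1\\ 1&0\end{pmatrix},$$ $\mathbb{I}_2$ the $2\times 2$ identity. $I_1=\begin{pmatrix}1&1\\ 1&1\end{pmatrix}$. $|\hat G_e(t,k)|$ denotes the matrix of absolute values of the entries, written in $2\times2$ blocks, and inequalities between matrices are entrywise. *)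

theory Defs
  imports "HOL-Analysis.Analysis"
begin

primrec mat_power :: "'a::semiring_1^'n^'n \<Rightarrow> nat \<Rightarrow> 'a^'n^'n" where
  "mat_power A 0 = mat 1"
| "mat_power A (Suc n) = A ** mat_power A n"

text \<open>
  The type-class multiplication and power on matrices act componentwise, so the matrix exponential
  is not an instance of \<^const>\<open>exp\<close>; it is introduced through its power series.
\<close>

definition mat_exp :: "complex^'n^'n \<Rightarrow> complex^'n^'n" where
  "mat_exp A = (\<Sum>n. (1 / fact n) *\<^sub>R mat_power A n)"

text \<open>
  A \<open>3 \<times> 3\<close> array of \<open>2 \<times> 2\<close> blocks, read as a \<open>6 \<times> 6\<close> matrix: the index \<open>(p, q)\<close> is the
  \<open>q\<close>-th component of the \<open>p\<close>-th of the three vectors \<open>u, E, B\<close>.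
\<close>

definition block_matrix :: "'a^2^2^3^3 \<Rightarrow> 'a^(3 \<times> 2)^(3 \<times> 2)" where
  "block_matrix M = (\<chi> i j. M $ fst i $ fst j $ snd i $ snd j)"

definition O1 :: "complex^2^2" where
  "O1 = vector [vector [0, -1], vector [1, 0]]"

definition I1 :: "real^2^2" where
  "I1 = vector [vector [1, 1], vector [1, 1]]"

text \<open>Here \<open>mat z ** M\<close> is the scalar multiple of \<open>M\<close> by the complex number \<open>z\<close>.\<close>

definition A_r :: "real \<Rightarrow> complex^(3 \<times> 2)^(3 \<times> 2)" where
  "A_r k = block_matrix (vector [
     vector [mat 1 - O1, mat 1,                           0],
     vector [- mat 1,    0,                               - (mat (\<i> * of_real k) ** O1)],
     vector [0,          mat (\<i> * of_real k) ** O1,       0]])"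

definition G_e :: "real \<Rightarrow> real \<Rightarrow> complex^(3 \<times> 2)^(3 \<times> 2)" where
  "G_e t k = mat_exp (- (t *\<^sub>R A_r k))"

lemma norm_mat_power_entry:
  fixes A :: "complex^'n^'n"
  shows "cmod (mat_power A n $ i $ j) \<le> (\<Sum>i\<in>UNIV. \<Sum>j\<in>UNIV. cmod (A $ i $ j)) ^ n"
proof (induction n arbitrary: i j)
  case 0
  then show ?case by (simp add: mat_def)
next
  case (Suc n)
  let ?K = "\<Sum>i\<in>UNIV. \<Sum>j\<in>UNIV. cmod (A $ i $ j)"
  have K: "0 \<le> ?K" by (simp add: sum_nonneg)
  have row: "(\<Sum>l\<in>UNIV. cmod (A $ i $ l)) \<le> ?K"
    by (rule member_le_sum[where f = "\<lambda>i. \<Sum>j\<in>UNIV. cmod (A $ i $ j)"]) (auto simp: sum_nonneg)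
  have "cmod (mat_power A (Suc n) $ i $ j) \<le> (\<Sum>l\<in>UNIV. cmod (A $ i $ l) * cmod (mat_power A n $ l $ j))"
    by (simp add: matrix_matrix_mult_def norm_mult[symmetric] norm_sum)
  also have "\<dots> \<le> (\<Sum>l\<in>UNIV. cmod (A $ i $ l) * ?K ^ n)"
    by (intro sum_mono mult_left_mono Suc.IH) auto
  also have "\<dots> = (\<Sum>l\<in>UNIV. cmod (A $ i $ l)) * ?K ^ n"
    by (simp add: sum_distrib_right)
  also have "\<dots> \<le> ?K * ?K ^ n"
    by (intro mult_right_mono row) (simp add: K)
  finally show ?case by simp
qed

lemma mat_exp_sums:
  fixes A :: "complex^'n^'n"
  shows "(\<lambda>n. (1 / fact n) *\<^sub>R mat_power A n) sums mat_exp A"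
proof -
  let ?K = "\<Sum>i\<in>UNIV. \<Sum>j\<in>UNIV. cmod (A $ i $ j)"
  let ?N = "real CARD('n)"
  have bound: "norm ((1 / fact n) *\<^sub>R mat_power A n) \<le> ?N * ?N * (inverse (fact n) * ?K ^ n)" for n
  proof -
    have "norm (mat_power A n) \<le> (\<Sum>i\<in>UNIV. norm (mat_power A n $ i))"
      unfolding norm_vec_def by (rule L2_set_le_sum) simp
    also have "\<dots> \<le> (\<Sum>i\<in>(UNIV::'n set). \<Sum>j\<in>(UNIV::'n set). ?K ^ n)"
    proof (intro sum_mono)
      fix i
      have "norm (mat_power A n $ i) \<le> (\<Sum>j\<in>UNIV. cmod (mat_power A n $ i $ j))"
        unfolding norm_vec_def by (rule L2_set_le_sum) simp
      also have "\<dots> \<le> (\<Sum>j\<in>(UNIV::'n set). ?K ^ n)"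
        by (intro sum_mono norm_mat_power_entry)
      finally show "norm (mat_power A n $ i) \<le> (\<Sum>j\<in>(UNIV::'n set). ?K ^ n)" .
    qed
    finally have "norm (mat_power A n) \<le> ?N * ?N * ?K ^ n" by simp
    then show ?thesis by (simp add: field_simps)
  qed
  have "summable (\<lambda>n. ?N * ?N * (inverse (fact n) * ?K ^ n))"
    by (intro summable_mult summable_exp)
  then have "summable (\<lambda>n. (1 / fact n) *\<^sub>R mat_power A n)"
    using bound by (rule summable_comparison_test')
  then show ?thesis
    unfolding mat_exp_def by (rule summable_sums)
qed

end

theory Submission
  imports Defs "HOL-Computational_Algebra.Fundamental_Theorem_Algebra"
begin

text \<open>
  The matrix \<open>O1\<close> is the rotation by a right angle, with eigenvalues \<open>\<plusminus>\<i>\<close>.  Splitting each of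
  \<open>u\<close>, \<open>E\<close>, \<open>B\<close> along its two eigenvectors (circular polarisations) decouples the \<open>6 \<times> 6\<close>
  system into two \<open>3 \<times> 3\<close> systems: with \<open>s = \<plusminus>1\<close>, \<open>a = 1 - \<i> s\<close> and \<open>q = k s\<close> the generator is
  \<open>mode_matrix a q\<close>, whose characteristic polynomial is the cubic
  \<open>p(z) = (z - a) (z\<^sup>2 + q\<^sup>2) + z\<close>.  If its roots are simple,
  \<open>exp (- t A)\<close> is the sum of \<open>exp (- t z) adj (z - A) / p'(z)\<close> over the roots \<open>z\<close>,
  and the adjugate is an explicit matrix of polynomials in \<open>z\<close>.  So three facts about the
  roots decide everything.

  \<^item> The roots are uniformly separated: \<open>|p'(z)| \<ge> (1 + q\<^sup>2) / 6\<close> at every root and for every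
    \<open>q\<close>.  The reason is that \<open>a\<^sup>2\<close> is purely imaginary and \<open>a\<^sup>4 = -4\<close>, so that the real part of
    the discriminant is \<open>-4 (m\<^sup>3 - 4 m + 4)\<close> with \<open>m = 1 + q\<^sup>2\<close>, which stays away from \<open>0\<close>
    (\<open>discriminant_lower_bound\<close>, \<open>root_separation\<close>).

  \<^item> The decay rate of a mode is a function of moduli only: a nonzero root satisfies
    \<open>Re z (|z|\<^sup>2 + (|z|\<^sup>2 + q\<^sup>2) |z - a|\<^sup>2) = |z|\<^sup>2\<close> (\<open>root_Re_identity\<close>).  Hence lower bounds on
    \<open>Re z\<close> reduce to crude bounds on \<open>|z|\<close> and \<open>|z - a|\<close>.

  \<^item> There is a gap in the moduli.  For small \<open>q\<close> a root is either of size \<open>q\<^sup>2\<close> (the slow,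
    diffusive mode) or of size \<open>1\<close>; for large \<open>q\<close> it is either close to \<open>a\<close> (the fast,
    damped mode) or of size \<open>|q|\<close>.  It does not matter how many roots are of which kind: each
    one alone contributes at most one of the two terms of the claimed bound.

  Each weight matrix in the bounds for small and large \<open>k\<close> has rank one, its entries being \<open>w\<^sub>i w\<^sub>j\<close>
  for a vector \<open>w\<close> that records the sizes of the \<open>u\<close>, \<open>E\<close>, \<open>B\<close> components of the
  corresponding eigenvectors.  For intermediate \<open>k\<close>, bounds on \<open>|z|\<close> from both sides turn the
  identity for \<open>Re z\<close> into a uniform positive decay rate.
\<close>

section \<open>The characteristic cubic of a circular mode\<close>

definition mode_matrix :: "complex \<Rightarrow> real \<Rightarrow> complex^3^3" where
  "mode_matrix a q = vector [
     vector [a, 1, 0],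
     vector [-1, 0, of_real q],
     vector [0, - of_real q, 0]]"

definition mode_poly :: "complex \<Rightarrow> real \<Rightarrow> complex \<Rightarrow> complex" where
  "mode_poly a q z = (z - a) * (z\<^sup>2 + of_real q ^ 2) + z"

definition mode_poly_deriv :: "complex \<Rightarrow> real \<Rightarrow> complex \<Rightarrow> complex" where
  "mode_poly_deriv a q z = 3 * z\<^sup>2 - 2 * a * z + (1 + of_real q ^ 2)"

text \<open>
  The adjugate of \<open>z - mode_matrix a q\<close>; at a root \<open>z\<close> of the cubic its columns
  lie in the eigenspace of \<open>z\<close>.
\<close>

definition mode_adjugate :: "complex \<Rightarrow> real \<Rightarrow> complex \<Rightarrow> complex^3^3" where
  "mode_adjugate a q z = vector [
     vector [z\<^sup>2 + of_real q ^ 2, z, of_real q],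
     vector [- z, (z - a) * z, of_real q * (z - a)],
     vector [of_real q, - (of_real q * (z - a)), (z - a) * z + 1]]"

text \<open>
  This is \<open>(z - A) adj (z - A) = p(z) = 0\<close>.
\<close>

lemma mode_matrix_mult_adjugate:
  assumes "mode_poly a q z = 0"
  shows "(mode_matrix a q ** mode_adjugate a q z) $ i $ j = z * mode_adjugate a q z $ i $ j"
proof -
  have "\<forall>i j. (mode_matrix a q ** mode_adjugate a q z) $ i $ j = z * mode_adjugate a q z $ i $ j"
    using assms
    unfolding forall_3 mode_matrix_def mode_adjugate_def mode_poly_def
    by (simp add: matrix_matrix_mult_def sum_3) (intro conjI; (simp add: algebra_simps power2_eq_square; fail | algebra))
  then show ?thesis by blast
qed

text \<open>
  One root exists by algebraic closedness; the other two solve the quadratic that remains.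
\<close>

lemma mode_poly_roots:
  fixes a :: complex and q :: real
  obtains x y z where "x + y + z = a" "x * y + x * z + y * z = 1 + of_real q ^ 2"
    "x * y * z = a * of_real q ^ 2"
proof -
  define Q where "Q = complex_of_real q ^ 2"
  have "degree [:- (a * Q), 1 + Q, - a, 1:] > 0" by simp
  then obtain x where "poly [:- (a * Q), 1 + Q, - a, 1:] x = 0"
    by (meson alg_closed_imp_poly_has_root)
  then have x: "x ^ 3 - a * x\<^sup>2 + (1 + Q) * x = a * Q"
    by (simp add: algebra_simps power2_eq_square power3_eq_cube)
  define w where "w = csqrt ((a - x)\<^sup>2 - 4 * (1 + Q + x\<^sup>2 - a * x))"
  have w: "w\<^sup>2 = (a - x)\<^sup>2 - 4 * (1 + Q + x\<^sup>2 - a * x)"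
    by (simp add: w_def)
  define y z where "y = (a - x + w) / 2" and "z = (a - x - w) / 2"
  have sum: "y + z = a - x" by (simp add: y_def z_def field_simps)
  have "4 * (y * z) = (a - x)\<^sup>2 - w\<^sup>2"
    by (simp add: y_def z_def field_simps power2_eq_square)
  also have "\<dots> = 4 * (1 + Q + x\<^sup>2 - a * x)"
    unfolding w by simp
  finally have prod: "y * z = 1 + Q + x\<^sup>2 - a * x"
    by (simp only: mult_cancel_left) simp
  show ?thesis
  proof (rule that[of x y z], unfold Q_def[symmetric])
    show "x + y + z = a" using sum by (simp add: algebra_simps)
    have "x * y + x * z + y * z = x * (y + z) + y * z" by (simp add: algebra_simps)
    also have "\<dots> = 1 + Q" unfolding sum prod by (simp add: algebra_simps power2_eq_square)
    finally show "x * y + x * z + y * z = 1 + Q" .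
    have "x * y * z = x * (y * z)" by simp
    also have "\<dots> = x ^ 3 - a * x\<^sup>2 + (1 + Q) * x"
      unfolding prod by (simp add: algebra_simps power2_eq_square power3_eq_cube)
    finally show "x * y * z = a * Q" using x by simp
  qed
qed

lemma mode_poly_factor:
  assumes "x + y + z = a" "x * y + x * z + y * z = 1 + of_real q ^ 2" "x * y * z = a * of_real q ^ 2"
  shows "mode_poly a q w = (w - x) * (w - y) * (w - z)"
proof -
  have "mode_poly a q w = w ^ 3 - a * w\<^sup>2 + (1 + of_real q ^ 2) * w - a * of_real q ^ 2"
    unfolding mode_poly_def by algebra
  also have "\<dots> = w ^ 3 - (x + y + z) * w\<^sup>2 + (x * y + x * z + y * z) * w - x * y * z"
    by (simp only: assms)
  also have "\<dots> = (w - x) * (w - y) * (w - z)"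
    by algebra
  finally show ?thesis .
qed

lemma mode_poly_deriv_factor:
  assumes "x + y + z = a" "x * y + x * z + y * z = 1 + of_real q ^ 2"
  shows "mode_poly_deriv a q x = (x - y) * (x - z)"
  unfolding mode_poly_deriv_def assms[symmetric] by algebra

lemma mult_le_mult_commuted:
  fixes c :: real
  assumes "c \<le> B" "e \<le> E" "0 \<le> c" "0 \<le> e"
  shows "e * c \<le> B * E"
  using mult_mono[OF assms(1,2)] assms by (simp add: mult.commute)

lemma cubic_discriminant:
  fixes x y z :: "'a::idom"
  shows "((x - y) * (x - z) * (y - z))\<^sup>2 =
    (x + y + z)\<^sup>2 * (x * y + x * z + y * z)\<^sup>2 - 4 * (x * y + x * z + y * z) ^ 3
    - 4 * (x + y + z) ^ 3 * (x * y * z) + 18 * (x + y + z) * (x * y + x * z + y * z) * (x * y * z)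
    - 27 * (x * y * z)\<^sup>2"
  by algebra

text \<open>
  The two values \<open>a = 1 \<plusminus> \<i>\<close> that come from the two circular polarisations are treated together.
\<close>

locale circular_mode =
  fixes a :: complex
  assumes Re_a: "Re a = 1" and Im_a: "(Im a)\<^sup>2 = 1"
begin

lemma norm_a_squared: "(cmod a)\<^sup>2 = 2"
  by (simp add: cmod_power2 Re_a Im_a)

lemma norm_a_le: "cmod a \<le> 3 / 2"
  by (rule power2_le_imp_le) (simp_all add: norm_a_squared power_divide)

lemma norm_a_ge: "7 / 5 \<le> cmod a"
  by (rule power2_le_imp_le) (simp_all add: norm_a_squared power_divide)

text \<open>
  In the discriminant, written in terms of the coefficients, \<open>a\<close> occurs only through \<open>a\<^sup>2\<close>, which
  is \<open>\<plusminus>2 \<i>\<close>, and \<open>a\<^sup>4 = -4\<close>.  All terms with the factor \<open>a\<^sup>2\<close> are imaginary, so the real part keeps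
  only \<open>-4 m\<^sup>3\<close> and \<open>16 (m - 1)\<close>, where the cubic term wins for all \<open>m \<ge> 1\<close>.
\<close>

lemma discriminant_lower_bound:
  assumes "x + y + z = a" "x * y + x * z + y * z = 1 + of_real q ^ 2" "x * y * z = a * of_real q ^ 2"
  shows "(1 + q\<^sup>2) ^ 3 \<le> (cmod ((x - y) * (x - z) * (y - z)))\<^sup>2"
proof -
  define m where "m = 1 + q\<^sup>2"
  have m: "m \<ge> 1" by (simp add: m_def)
  define b where "b = 2 * Im a"
  have b2: "b\<^sup>2 = 4" by (simp add: b_def power_mult_distrib Im_a)
  have a2: "a\<^sup>2 = \<i> * of_real b"
    using Im_a by (simp add: complex_eq_iff power2_eq_square Re_a b_def)
  have a4: "a ^ 4 = - 4"
  proof -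
    have "a ^ 4 = (a\<^sup>2)\<^sup>2" by simp
    also have "\<dots> = - of_real (b\<^sup>2)" unfolding a2 by (simp add: power_mult_distrib)
    finally show ?thesis by (simp add: b2)
  qed
  have q2: "of_real q ^ 2 = of_real m - (1::complex)" by (simp add: m_def)
  have "((x - y) * (x - z) * (y - z))\<^sup>2 =
    a\<^sup>2 * (1 + of_real q ^ 2)\<^sup>2 - 4 * (1 + of_real q ^ 2) ^ 3 - 4 * a ^ 3 * (a * of_real q ^ 2)
    + 18 * a * (1 + of_real q ^ 2) * (a * of_real q ^ 2) - 27 * (a * of_real q ^ 2)\<^sup>2"
    by (subst cubic_discriminant) (simp only: assms)
  also have "\<dots> = a\<^sup>2 * of_real m ^ 2 - 4 * of_real m ^ 3 - 4 * a ^ 4 * (of_real m - 1)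
    + 18 * a\<^sup>2 * of_real m * (of_real m - 1) - 27 * a\<^sup>2 * (of_real m - 1)\<^sup>2"
    unfolding q2 by (simp add: algebra_simps power2_eq_square power3_eq_cube power4_eq_xxxx)
  also have "\<dots> = of_real (16 * (m - 1) - 4 * m ^ 3)
      + \<i> * of_real (b * (m\<^sup>2 + 18 * m * (m - 1) - 27 * (m - 1)\<^sup>2))"
    unfolding a2 a4 by (simp add: algebra_simps)
  finally have "Re (((x - y) * (x - z) * (y - z))\<^sup>2) = 16 * (m - 1) - 4 * m ^ 3"
    by simp
  then have "4 * m ^ 3 - 16 * (m - 1) \<le> cmod (((x - y) * (x - z) * (y - z))\<^sup>2)"
    using abs_Re_le_cmod[of "((x - y) * (x - z) * (y - z))\<^sup>2"] by linarith
  moreover have "m ^ 3 \<le> 4 * m ^ 3 - 16 * (m - 1)"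
  proof -
    \<comment> \<open>The line \<open>16 m - 128 / 9\<close> is the tangent to \<open>3 m\<^sup>3\<close> at \<open>m = 4 / 3\<close>, and \<open>128 / 9 < 16\<close>.\<close>
    have "3 * m ^ 3 - 16 * m + 128 / 9 = 3 * (m - 4 / 3)\<^sup>2 * (m + 8 / 3)"
      by (simp add: power2_eq_square power3_eq_cube algebra_simps)
    also have "0 \<le> \<dots>" using m by simp
    finally show ?thesis by simp
  qed
  ultimately show ?thesis by (simp add: m_def norm_power)
qed

text \<open>
  Beyond this radius the leading term \<open>z\<^sup>3\<close> dominates the sum of the others.
\<close>

lemma root_norm_le:
  assumes "mode_poly a q z = 0"
  shows "cmod z \<le> 3 * sqrt (1 + q\<^sup>2)"
proof (rule ccontr)
  define r n where "r = cmod z" and "n = sqrt (1 + q\<^sup>2)"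
  assume "\<not> cmod z \<le> 3 * sqrt (1 + q\<^sup>2)"
  then have rn: "3 * n < r" by (simp add: r_def n_def)
  have n2: "n\<^sup>2 = 1 + q\<^sup>2" by (simp add: n_def)
  have n1: "1 \<le> n" by (simp add: n_def)
  have "z ^ 3 = a * z\<^sup>2 - of_real (1 + q\<^sup>2) * z + a * of_real (q\<^sup>2)"
    using assms unfolding mode_poly_def of_real_add of_real_power of_real_1 by algebra
  then have "r ^ 3 = cmod (a * z\<^sup>2 - of_real (1 + q\<^sup>2) * z + a * of_real (q\<^sup>2))"
    by (metis norm_power r_def)
  also have "\<dots> \<le> cmod (a * z\<^sup>2) + cmod (of_real (1 + q\<^sup>2) * z) + cmod (a * of_real (q\<^sup>2))"
    by (meson add_mono norm_triangle_ineq norm_triangle_ineq4 order_refl order_trans)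
  also have "\<dots> = cmod a * r\<^sup>2 + n\<^sup>2 * r + cmod a * q\<^sup>2"
    by (simp only: norm_mult norm_power norm_of_real r_def n2) simp
  also have "\<dots> \<le> (3 / 2) * r\<^sup>2 + n\<^sup>2 * r + (3 / 2) * n\<^sup>2"
    using norm_a_le by (intro add_mono mult_mono order_refl) (auto simp: n2)
  finally have le: "r ^ 3 \<le> (3 / 2) * r\<^sup>2 + n\<^sup>2 * r + (3 / 2) * n\<^sup>2" .
  have "9 * n\<^sup>2 \<le> r\<^sup>2"
    using power_mono[of "3 * n" r 2] rn n1 by (simp add: power_mult_distrib)
  moreover from this have "9 * n\<^sup>2 * r \<le> r\<^sup>2 * r"
    using rn n1 by (intro mult_right_mono) auto
  moreover have "3 * r\<^sup>2 \<le> r * r\<^sup>2" "0 < r * r\<^sup>2"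
    using rn n1 by (auto intro!: mult_right_mono)
  ultimately show False using le by (simp add: power2_eq_square power3_eq_cube)
qed

text \<open>
  With \<open>n = sqrt (1 + q\<^sup>2)\<close>, the product of all three differences is at least \<open>n\<^sup>3\<close> by the
  discriminant bound, and the difference that does not involve \<open>x\<close> is at most \<open>6 n\<close>.
\<close>

lemma root_separation:
  assumes "x + y + z = a" "x * y + x * z + y * z = 1 + of_real q ^ 2" "x * y * z = a * of_real q ^ 2"
  shows "(1 + q\<^sup>2) / 6 \<le> cmod ((x - y) * (x - z))"
proof -
  define n where "n = sqrt (1 + q\<^sup>2)"
  have n2: "n\<^sup>2 = 1 + q\<^sup>2" by (simp add: n_def)
  have n1: "1 \<le> n" by (simp add: n_def)
  have "(n ^ 3)\<^sup>2 = (1 + q\<^sup>2) ^ 3"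
    by (simp add: n2[symmetric] flip: power_mult)
  then have "(n ^ 3)\<^sup>2 \<le> (cmod ((x - y) * (x - z) * (y - z)))\<^sup>2"
    using discriminant_lower_bound[OF assms] by simp
  then have "n ^ 3 \<le> cmod ((x - y) * (x - z)) * cmod (y - z)"
    unfolding norm_mult[symmetric] by (rule power2_le_imp_le) simp
  also have "\<dots> \<le> cmod ((x - y) * (x - z)) * (6 * n)"
  proof (rule mult_left_mono)
    have "mode_poly a q y = 0" "mode_poly a q z = 0"
      by (simp_all add: mode_poly_factor[OF assms])
    then have "cmod y \<le> 3 * n" "cmod z \<le> 3 * n"
      unfolding n_def by (simp_all only: root_norm_le)
    then show "cmod (y - z) \<le> 6 * n"
      using norm_triangle_ineq4[of y z] by linarith
  qed simp
  finally have "n\<^sup>2 * n \<le> (6 * cmod ((x - y) * (x - z))) * n"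
    by (simp add: power2_eq_square power3_eq_cube algebra_simps)
  then show ?thesis using n1 by (simp add: n2)
qed

lemma root_set:
  obtains x y z where "distinct [x, y, z]" "{w. mode_poly a q w = 0} = {x, y, z}"
    "mode_poly_deriv a q x = (x - y) * (x - z)"
    "mode_poly_deriv a q y = (y - x) * (y - z)"
    "mode_poly_deriv a q z = (z - x) * (z - y)"
    "(1 + q\<^sup>2) / 6 \<le> cmod (mode_poly_deriv a q x)"
    "(1 + q\<^sup>2) / 6 \<le> cmod (mode_poly_deriv a q y)"
    "(1 + q\<^sup>2) / 6 \<le> cmod (mode_poly_deriv a q z)"
proof -
  obtain x y z where v: "x + y + z = a" "x * y + x * z + y * z = 1 + of_real q ^ 2"
    "x * y * z = a * of_real q ^ 2"
    by (rule mode_poly_roots)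
  then have vy: "y + x + z = a" "y * x + y * z + x * z = 1 + of_real q ^ 2"
      "y * x * z = a * of_real q ^ 2"
    and vz: "z + x + y = a" "z * x + z * y + x * y = 1 + of_real q ^ 2"
      "z * x * y = a * of_real q ^ 2"
    by (simp_all add: ac_simps)
  have sep: "(1 + q\<^sup>2) / 6 \<le> cmod ((x - y) * (x - z))" "(1 + q\<^sup>2) / 6 \<le> cmod ((y - x) * (y - z))"
      "(1 + q\<^sup>2) / 6 \<le> cmod ((z - x) * (z - y))"
    using root_separation[OF v] root_separation[OF vy] root_separation[OF vz] .
  have pos: "0 < (1 + q\<^sup>2) / 6" by (simp add: add_pos_nonneg)
  have "distinct [x, y, z]" using sep pos by auto
  then show ?thesis
  proof (rule that)
    show "{w. mode_poly a q w = 0} = {x, y, z}"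
      by (auto simp: mode_poly_factor[OF v])
  qed (use sep v vy vz in \<open>simp_all only: mode_poly_deriv_factor\<close>)
qed

lemma mode_poly_deriv_lower_bound:
  assumes "mode_poly a q w = 0"
  shows "(1 + q\<^sup>2) / 6 \<le> cmod (mode_poly_deriv a q w)"
proof -
  obtain x y z where "{w. mode_poly a q w = 0} = {x, y, z}"
    and "(1 + q\<^sup>2) / 6 \<le> cmod (mode_poly_deriv a q x)"
    "(1 + q\<^sup>2) / 6 \<le> cmod (mode_poly_deriv a q y)"
    "(1 + q\<^sup>2) / 6 \<le> cmod (mode_poly_deriv a q z)"
    by (rule root_set)
  moreover from this(1) have "w \<in> {x, y, z}" using assms by blast
  ultimately show ?thesis by auto
qed

lemma finite_roots: "finite {z. mode_poly a q z = 0}"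
  by (rule root_set[of q]) simp

lemma card_roots: "card {z. mode_poly a q z = 0} = 3"
  by (rule root_set[of q]) simp

text \<open>
  As a function of \<open>z\<close> the adjugate is \<open>z\<^sup>2\<close> times the identity plus terms of lower degree, and
  Lagrange interpolation at three points extracts the leading coefficient of a quadratic.
\<close>

lemma mode_resolution_of_identity:
  "(\<Sum>z | mode_poly a q z = 0. mode_adjugate a q z $ i $ j / mode_poly_deriv a q z) = mat 1 $ i $ j"
proof -
  obtain x y z where d: "distinct [x, y, z]" and S: "{w. mode_poly a q w = 0} = {x, y, z}"
    and deriv: "mode_poly_deriv a q x = (x - y) * (x - z)"
    "mode_poly_deriv a q y = (y - x) * (y - z)"
    "mode_poly_deriv a q z = (z - x) * (z - y)"
    by (rule root_set)
  have interpolation: "(\<Sum>w\<in>{x, y, z}. (\<alpha> * w\<^sup>2 + \<beta> * w + \<gamma>) / mode_poly_deriv a q w) = \<alpha>" for \<alpha> \<beta> \<gamma>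
  proof -
    define N where "N w = \<alpha> * w\<^sup>2 + \<beta> * w + \<gamma>" for w
    define u v w where "u = x - y" and "v = x - z" and "w = y - z"
    have "N x * w - N y * v + N z * u = \<alpha> * (u * v * w)"
      unfolding N_def u_def v_def w_def by algebra
    moreover have "u \<noteq> 0" "v \<noteq> 0" "w \<noteq> 0"
      using d by (auto simp: u_def v_def w_def)
    ultimately have "N x / (u * v) + N y / (- u * w) + N z / (- v * - w) = \<alpha>"
      by (simp add: field_simps)
    then have "N x / ((x - y) * (x - z)) + N y / ((y - x) * (y - z)) + N z / ((z - x) * (z - y)) = \<alpha>"
      by (simp add: u_def v_def w_def)
    then show ?thesis using d by (simp add: deriv add.assoc N_def)
  qed
  define \<beta> :: "complex^3^3" where
    "\<beta> = vector [vector [0, 1, 0], vector [-1, -a, of_real q], vector [0, - of_real q, - a]]"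
  define \<gamma> :: "complex^3^3" where
    "\<gamma> = vector [vector [of_real q ^ 2, 0, of_real q], vector [0, 0, - of_real q * a],
      vector [of_real q, of_real q * a, 1]]"
  have "\<forall>i j. mode_adjugate a q w $ i $ j = mat 1 $ i $ j * w\<^sup>2 + \<beta> $ i $ j * w + \<gamma> $ i $ j" for w
    unfolding forall_3 mode_adjugate_def \<beta>_def \<gamma>_def
    by (simp add: mat_def algebra_simps power2_eq_square)
  then show ?thesis unfolding S by (simp only: interpolation)
qed


section \<open>Decay rates of the roots\<close>

text \<open>
  Three rearrangements of \<open>p(z) = 0\<close>, read off in absolute value.  The second one makes the
  lower right entry \<open>(z - a) z + 1\<close> of the adjugate small where \<open>q\<^sup>2 |z - a| / |z|\<close> is; the third one ties a small
  root to the size of \<open>q\<^sup>2\<close>.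
\<close>

lemma root_moduli:
  assumes "mode_poly a q z = 0"
  shows "cmod (z - a) * cmod (z\<^sup>2 + of_real q ^ 2) = cmod z"
    and "cmod z * cmod ((z - a) * z + 1) = q\<^sup>2 * cmod (z - a)"
    and "cmod z * cmod ((z - a) * z + of_real (1 + q\<^sup>2)) = cmod a * q\<^sup>2"
proof -
  define D where "D = z\<^sup>2 + of_real q ^ 2"
  have p: "(z - a) * D = - z"
    using assms by (simp add: mode_poly_def D_def add_eq_0_iff2)
  have "cmod ((z - a) * D) = cmod z" by (simp add: p)
  then show "cmod (z - a) * cmod (z\<^sup>2 + of_real q ^ 2) = cmod z"
    by (simp add: norm_mult D_def)
  have "z * ((z - a) * z + 1) = (z - a) * D + z - of_real (q\<^sup>2) * (z - a)"
    by (simp add: D_def algebra_simps power2_eq_square)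
  then have "z * ((z - a) * z + 1) = - (of_real (q\<^sup>2) * (z - a))"
    by (simp add: p)
  then have "cmod (z * ((z - a) * z + 1)) = cmod (of_real (q\<^sup>2) * (z - a))"
    by (simp only: norm_minus_cancel)
  then show "cmod z * cmod ((z - a) * z + 1) = q\<^sup>2 * cmod (z - a)"
    unfolding norm_mult norm_of_real by simp
  have "z * ((z - a) * z + of_real (1 + q\<^sup>2)) = (z - a) * D + z + a * of_real (q\<^sup>2)"
    by (simp add: D_def algebra_simps power2_eq_square)
  then have "cmod (z * ((z - a) * z + of_real (1 + q\<^sup>2))) = cmod (a * of_real (q\<^sup>2))"
    by (simp add: p)
  then show "cmod z * cmod ((z - a) * z + of_real (1 + q\<^sup>2)) = cmod a * q\<^sup>2"
    unfolding norm_mult norm_of_real by simp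
qed

lemma norm_diff_a_le: "cmod (z - a) \<le> cmod z + 3 / 2"
  using norm_triangle_ineq4[of z a] norm_a_le by linarith

lemma norm_diff_a_ge: "cmod z - 3 / 2 \<le> cmod (z - a)"
  using norm_triangle_ineq2[of z a] norm_a_le by linarith

text \<open>
  Write the equation as \<open>a - z = z / D\<close> with \<open>D = z\<^sup>2 + q\<^sup>2\<close> and take real parts.  Since
  \<open>z \<cdot> cnj D = |z|\<^sup>2 cnj z + q\<^sup>2 z\<close>, the right-hand side has the real part
  \<open>Re z (|z|\<^sup>2 + q\<^sup>2) / |D|\<^sup>2\<close>; finally \<open>|D| = |z| / |z - a|\<close>.
\<close>

lemma root_Re_identity:
  assumes root: "mode_poly a q z = 0" and "z \<noteq> 0"
  shows "Re z * ((cmod z)\<^sup>2 + ((cmod z)\<^sup>2 + q\<^sup>2) * (cmod (z - a))\<^sup>2) = (cmod z)\<^sup>2"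
proof -
  define D where "D = z\<^sup>2 + of_real q ^ 2"
  define d r2 q2 where "d = (cmod D)\<^sup>2" and "r2 = (cmod z)\<^sup>2" and "q2 = q\<^sup>2"
  have "(a - z) * D = z"
    using root by (simp add: mode_poly_def D_def algebra_simps)
  then have "(a - z) * of_real d = z * cnj D"
    unfolding d_def complex_norm_square by (metis mult.assoc)
  also have "\<dots> = of_real r2 * cnj z + of_real q2 * z"
    unfolding r2_def q2_def complex_norm_square
    by (simp add: D_def algebra_simps power2_eq_square)
  finally have "Re ((a - z) * of_real d) = Re (of_real r2 * cnj z + of_real q2 * z)"
    by simp
  then have "(1 - Re z) * d = Re z * (r2 + q2)"
    by (simp add: Re_a algebra_simps)
  then have "(1 - Re z) * (cmod D)\<^sup>2 = Re z * ((cmod z)\<^sup>2 + q\<^sup>2)"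
    by (simp only: d_def r2_def q2_def)
  then have "(1 - Re z) * (cmod D)\<^sup>2 * (cmod (z - a))\<^sup>2 = Re z * ((cmod z)\<^sup>2 + q\<^sup>2) * (cmod (z - a))\<^sup>2"
    by (simp only:)
  then have "(1 - Re z) * ((cmod (z - a))\<^sup>2 * (cmod D)\<^sup>2) = Re z * ((cmod z)\<^sup>2 + q\<^sup>2) * (cmod (z - a))\<^sup>2"
    by (simp only: mult_ac)
  moreover have "(cmod (z - a))\<^sup>2 * (cmod D)\<^sup>2 = (cmod z)\<^sup>2"
    using root_moduli(1)[OF root] by (simp add: D_def flip: power_mult_distrib)
  ultimately show ?thesis by (simp add: algebra_simps)
qed

lemma root_Re_lower_bound:
  assumes root: "mode_poly a q z = 0" and "z \<noteq> 0" and "0 \<le> K"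
    and K: "((cmod z)\<^sup>2 + q\<^sup>2) * (cmod (z - a))\<^sup>2 \<le> K * (cmod z)\<^sup>2"
  shows "1 / (1 + K) \<le> Re z"
proof -
  define r2 e where "r2 = (cmod z)\<^sup>2" and "e = ((cmod z)\<^sup>2 + q\<^sup>2) * (cmod (z - a))\<^sup>2"
  have r2: "0 < r2" using assms(2) by (simp add: r2_def)
  have e: "0 \<le> e" by (simp add: e_def)
  have id: "Re z * (r2 + e) = r2"
    using root_Re_identity[OF assms(1,2)] by (simp add: r2_def e_def)
  then have "0 < Re z"
    using r2 e by (metis add_pos_nonneg zero_less_mult_pos2)
  then have "r2 \<le> Re z * (r2 + K * r2)"
    using K by (subst id[symmetric], intro mult_left_mono) (auto simp: e_def r2_def)
  then have "1 * r2 \<le> (Re z * (1 + K)) * r2" by (simp add: algebra_simps)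
  then have "1 \<le> Re z * (1 + K)" using r2 by (simp only: mult_le_cancel_right_pos)
  then show ?thesis using assms(3) by (simp add: divide_le_eq)
qed

text \<open>
  The moduli of the adjugate are symmetric in the two indices, so six inequalities cover its nine entries.
\<close>

lemma mode_adjugate_bound:
  fixes w :: "real^3"
  assumes "cmod (z\<^sup>2 + of_real q ^ 2) \<le> B * (w $ 1 * w $ 1)"
    "cmod z \<le> B * (w $ 1 * w $ 2)"
    "\<bar>q\<bar> \<le> B * (w $ 1 * w $ 3)"
    "cmod (z - a) * cmod z \<le> B * (w $ 2 * w $ 2)"
    "\<bar>q\<bar> * cmod (z - a) \<le> B * (w $ 2 * w $ 3)"
    "cmod ((z - a) * z + 1) \<le> B * (w $ 3 * w $ 3)"
  shows "cmod (mode_adjugate a q z $ i $ j) \<le> B * (w $ i * w $ j)"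
proof -
  have "\<forall>i j. cmod (mode_adjugate a q z $ i $ j) \<le> B * (w $ i * w $ j)"
    using assms unfolding forall_3 mode_adjugate_def
    by (simp add: norm_mult mult.commute)
  then show ?thesis by blast
qed

text \<open>
  Here \<open>z \<approx> a q\<^sup>2\<close>, so the true rate is about \<open>q\<^sup>2\<close>; asking only for \<open>q\<^sup>2 / 2\<close> leaves a
  factor of two for the rough estimates of \<open>|z|\<close> from both sides.
\<close>

lemma small_slow_root:
  assumes root: "mode_poly a q z = 0" and q: "\<bar>q\<bar> \<le> 1 / 100" and r: "cmod z \<le> 1 / 4"
  shows "cmod z \<le> 8 / 3 * q\<^sup>2" and "q\<^sup>2 / 2 \<le> Re z"
proof -
  define r x M where "r = cmod z" and "x = cmod (z - a)"
    and "M = cmod ((z - a) * z + of_real (1 + q\<^sup>2))"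
  have q2: "q\<^sup>2 \<le> 1 / 10000"
    using power_mono[OF q, of 2] by (simp add: power_divide)
  have r0: "0 \<le> r" "r \<le> 1 / 4" using r by (simp_all add: r_def)
  have x: "0 \<le> x" "x \<le> r + 3 / 2" using norm_diff_a_le by (simp_all add: x_def r_def)
  have n: "cmod ((z - a) * z) = x * r" "cmod (of_real (1 + q\<^sup>2)) = 1 + q\<^sup>2"
    by (simp_all only: norm_mult norm_of_real x_def r_def) simp
  have M: "(1 + q\<^sup>2) - x * r \<le> M" "M \<le> x * r + (1 + q\<^sup>2)"
    using norm_diff_ineq[of "of_real (1 + q\<^sup>2)" "(z - a) * z"]
      norm_triangle_ineq[of "(z - a) * z" "of_real (1 + q\<^sup>2)"]
    unfolding M_def n by (simp_all add: add.commute)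
  have rM: "r * M = cmod a * q\<^sup>2"
    using root_moduli(3)[OF root] by (simp only: r_def M_def)
  have "x * r \<le> (7 / 4) * (1 / 4)"
    using r0 x by (intro mult_mono) auto
  then have "9 / 16 \<le> M" using M(1) zero_le_power2[of q] by linarith
  then have "r * (9 / 16) \<le> r * M" using r0 by (intro mult_left_mono) auto
  also have "\<dots> \<le> (3 / 2) * q\<^sup>2"
    unfolding rM using norm_a_le by (intro mult_right_mono) auto
  finally have r1: "r \<le> 8 / 3 * q\<^sup>2" by simp
  then show "cmod z \<le> 8 / 3 * q\<^sup>2" by (simp add: r_def)
  show "q\<^sup>2 / 2 \<le> Re z"
  proof (cases "q = 0")
    case True
    then show ?thesis using r1 by (simp add: r_def)
  next
    case False
    then have q0: "0 < q\<^sup>2" by simp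
    have x2: "x \<le> 151 / 100" using x r1 q2 by linarith
    have "x * r \<le> 2 * (8 / 3 * q\<^sup>2)" using x2 x r1 r0 by (intro mult_mono) auto
    then have "M \<le> 101 / 100" using M(2) q2 by linarith
    then have "r * M \<le> r * (101 / 100)" using r0 by (intro mult_left_mono) auto
    moreover have "7 / 5 * q\<^sup>2 \<le> r * M"
      unfolding rM using norm_a_ge by (intro mult_right_mono) auto
    ultimately have r2: "138 / 100 * q\<^sup>2 \<le> r" using q0 by linarith
    have rpos: "0 < r" using r2 q0 by linarith
    have "(138 / 100 * q\<^sup>2) * (138 / 100 * q\<^sup>2) \<le> r * r"
      using r2 q0 rpos by (intro mult_mono) auto
    moreover have "0 \<le> q\<^sup>2 * q\<^sup>2" by simp
    ultimately have lower: "19 / 10 * q\<^sup>2 * q\<^sup>2 \<le> r\<^sup>2"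
      unfolding power2_eq_square[of r] by linarith
    \<comment> \<open>\<open>K = 2 / q\<^sup>2 - 1\<close> is the value for which \<open>1 / (1 + K) = q\<^sup>2 / 2\<close>.\<close>
    have "1 / (1 + (2 / q\<^sup>2 - 1)) \<le> Re z"
    proof (rule root_Re_lower_bound[OF root])
      show "z \<noteq> 0" using rpos by (auto simp: r_def)
      show "0 \<le> 2 / q\<^sup>2 - 1" using q0 q2 by (simp add: field_simps)
      have "r\<^sup>2 \<le> (8 / 3 * q\<^sup>2)\<^sup>2" using r1 r0 by (intro power_mono) auto
      also have "\<dots> = 64 / 9 * q\<^sup>2 * q\<^sup>2" by (simp add: power2_eq_square)
      also have "\<dots> \<le> 64 / 9 * (1 / 10000) * q\<^sup>2" using q2 by (intro mult_right_mono) auto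
      finally have "r\<^sup>2 + q\<^sup>2 \<le> 101 / 100 * q\<^sup>2" using zero_le_power2[of q] by linarith
      moreover have "x\<^sup>2 \<le> (151 / 100)\<^sup>2" using x2 x by (intro power_mono) auto
      ultimately have "(r\<^sup>2 + q\<^sup>2) * x\<^sup>2 \<le> (101 / 100 * q\<^sup>2) * (151 / 100)\<^sup>2"
        by (intro mult_mono) auto
      also have "\<dots> \<le> 3 * q\<^sup>2" using q0 by (simp add: power_divide)
      also have "\<dots> \<le> (199 / 100) * (19 / 10 * q\<^sup>2)" using q0 by simp
      also have "\<dots> = (199 / 100) * ((19 / 10 * q\<^sup>2 * q\<^sup>2) / q\<^sup>2)" using q0 by simp
      also have "\<dots> \<le> (2 - q\<^sup>2) * (r\<^sup>2 / q\<^sup>2)"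
        using q0 q2 lower by (intro mult_mono divide_right_mono) auto
      also have "\<dots> = (2 / q\<^sup>2 - 1) * r\<^sup>2" using q0 by (simp add: field_simps)
      finally show "((cmod z)\<^sup>2 + q\<^sup>2) * (cmod (z - a))\<^sup>2 \<le> (2 / q\<^sup>2 - 1) * (cmod z)\<^sup>2"
        by (simp add: r_def x_def)
    qed
    then show ?thesis by simp
  qed
qed

text \<open>
  At \<open>q = 0\<close> the root satisfies \<open>z (z - a) = -1\<close>.  For small \<open>q\<close> the product \<open>|z| |z - a|\<close> is
  still nearly \<open>1\<close>, and since \<open>|z|\<close> and \<open>|z - a|\<close> differ by at most \<open>3 / 2\<close>, this bounds
  \<open>|z - a|\<close>.
\<close>

lemma small_fast_root:
  assumes root: "mode_poly a q z = 0" and q: "\<bar>q\<bar> \<le> 1 / 100" and r: "1 / 4 \<le> cmod z"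
  shows "cmod (z - a) \<le> 21 / 10" and "1 / 8 \<le> Re z"
proof -
  define r x where "r = cmod z" and "x = cmod (z - a)"
  have "q\<^sup>2 \<le> 1 / 10000"
    using power_mono[OF q, of 2] by (simp add: power_divide)
  moreover have "1 / 16 \<le> r\<^sup>2"
    using power_mono[OF r, of 2] by (simp add: r_def power_divide)
  ultimately have q2: "q\<^sup>2 \<le> 2 / 1000 * r\<^sup>2" by linarith
  have r0: "0 < r" using r unfolding r_def by linarith
  have x: "0 \<le> x" "x \<le> r + 3 / 2" using norm_diff_a_le by (simp_all add: x_def r_def)
  have "r\<^sup>2 - q\<^sup>2 \<le> cmod (z\<^sup>2 + of_real q ^ 2)"
    using norm_diff_ineq[of "z\<^sup>2" "of_real q ^ 2"] by (simp add: r_def norm_power)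
  then have "998 / 1000 * r\<^sup>2 \<le> cmod (z\<^sup>2 + of_real q ^ 2)" using q2 by linarith
  then have "x * (998 / 1000 * r\<^sup>2) \<le> x * cmod (z\<^sup>2 + of_real q ^ 2)"
    using x(1) by (rule mult_left_mono)
  also have "\<dots> = r" unfolding x_def r_def by (rule root_moduli(1)[OF root])
  finally have "(998 / 1000 * (x * r)) * r \<le> 1 * r" by (simp add: power2_eq_square)
  then have xr: "998 / 1000 * (x * r) \<le> 1" using r0 by (simp only: mult_le_cancel_right_pos)
  have x2: "x \<le> 21 / 10"
  proof (rule ccontr)
    assume "\<not> x \<le> 21 / 10"
    then have "21 / 10 * (6 / 10) \<le> x * r" using x by (intro mult_mono) auto
    then show False using xr by simp
  qed
  then show "cmod (z - a) \<le> 21 / 10" by (simp add: x_def)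
  have "1 / (1 + 7) \<le> Re z"
  proof (rule root_Re_lower_bound[OF root])
    show "z \<noteq> 0" using r0 by (auto simp: r_def)
    have "x\<^sup>2 \<le> (21 / 10)\<^sup>2" using x x2 by (intro power_mono) auto
    then have "(r\<^sup>2 + q\<^sup>2) * x\<^sup>2 \<le> (1002 / 1000 * r\<^sup>2) * (21 / 10)\<^sup>2"
      using q2 by (intro mult_mono) auto
    also have "\<dots> \<le> 7 * r\<^sup>2" by (simp add: power_divide)
    finally show "((cmod z)\<^sup>2 + q\<^sup>2) * (cmod (z - a))\<^sup>2 \<le> 7 * (cmod z)\<^sup>2"
      by (simp add: r_def x_def)
  qed simp
  then show "1 / 8 \<le> Re z" by simp
qed

text \<open>
  As \<open>z\<close> stays away from \<open>\<plusminus>\<i> q\<close>, the equation forces \<open>|z - a| = |z| / |z\<^sup>2 + q\<^sup>2|\<close> to be tiny.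
\<close>

lemma large_fast_root:
  assumes root: "mode_poly a q z = 0" and q: "100 \<le> \<bar>q\<bar>" and r: "cmod z \<le> \<bar>q\<bar> / 2"
  shows "cmod z \<le> 2" and "3 / 4 * (cmod (z - a) * q\<^sup>2) \<le> cmod z" and "1 / 2 \<le> Re z"
proof -
  define r x where "r = cmod z" and "x = cmod (z - a)"
  have q2: "10000 \<le> q\<^sup>2"
    using power_mono[OF q, of 2] by simp
  have r0: "0 \<le> r" by (simp add: r_def)
  have rq: "4 * r\<^sup>2 \<le> q\<^sup>2"
    using power_mono[OF r, of 2] by (simp add: r_def power_divide)
  have x: "0 \<le> x" by (simp add: x_def)
  have "q\<^sup>2 - r\<^sup>2 \<le> cmod (z\<^sup>2 + of_real q ^ 2)"
    using norm_diff_ineq[of "of_real q ^ 2" "z\<^sup>2"] by (simp add: r_def norm_power add.commute)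
  then have "3 / 4 * q\<^sup>2 \<le> cmod (z\<^sup>2 + of_real q ^ 2)" using rq by linarith
  then have "x * (3 / 4 * q\<^sup>2) \<le> x * cmod (z\<^sup>2 + of_real q ^ 2)"
    using x by (rule mult_left_mono)
  also have "\<dots> = r" unfolding x_def r_def by (rule root_moduli(1)[OF root])
  finally have xq: "3 / 4 * (x * q\<^sup>2) \<le> r" by simp
  have "x * 10000 \<le> x * q\<^sup>2" using x q2 by (rule mult_left_mono[rotated])
  moreover have "r - 3 / 2 \<le> x" using norm_diff_a_ge by (simp add: r_def x_def)
  ultimately have r2: "r \<le> 2" using xq by linarith
  then show "cmod z \<le> 2" by (simp add: r_def)
  show "3 / 4 * (cmod (z - a) * q\<^sup>2) \<le> cmod z" using xq by (simp only: r_def x_def)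
  have z0: "z \<noteq> 0"
    using root q2 norm_a_ge by (auto simp: mode_poly_def)
  have "1 / (1 + 1) \<le> Re z"
  proof (rule root_Re_lower_bound[OF root z0])
    have "(3 / 4 * (x * q\<^sup>2))\<^sup>2 \<le> r\<^sup>2" using xq x by (intro power_mono) auto
    then have "(x\<^sup>2 * q\<^sup>2) * q\<^sup>2 \<le> 16 / 9 * r\<^sup>2"
      by (simp add: power_mult_distrib power_divide power2_eq_square mult_ac)
    moreover have "(x\<^sup>2 * q\<^sup>2) * 10000 \<le> (x\<^sup>2 * q\<^sup>2) * q\<^sup>2"
      using q2 by (intro mult_left_mono) auto
    moreover have "r\<^sup>2 * x\<^sup>2 \<le> q\<^sup>2 * x\<^sup>2"
      using rq by (intro mult_right_mono) (auto simp: order_trans[OF _ rq])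
    moreover have "(r\<^sup>2 + q\<^sup>2) * x\<^sup>2 = r\<^sup>2 * x\<^sup>2 + x\<^sup>2 * q\<^sup>2" "q\<^sup>2 * x\<^sup>2 = x\<^sup>2 * q\<^sup>2"
      by (simp_all add: algebra_simps)
    ultimately have "(r\<^sup>2 + q\<^sup>2) * x\<^sup>2 \<le> 1 * r\<^sup>2"
      using zero_le_power2[of r] by linarith
    then show "((cmod z)\<^sup>2 + q\<^sup>2) * (cmod (z - a))\<^sup>2 \<le> 1 * (cmod z)\<^sup>2"
      by (simp add: r_def x_def)
  qed simp
  then show "1 / 2 \<le> Re z" by simp
qed

text \<open>
  As \<open>z\<close> is far from \<open>a\<close>, the quantity \<open>|z\<^sup>2 + q\<^sup>2| = |z| / |z - a|\<close> is bounded, so \<open>|z|\<^sup>2\<close> is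
  \<open>q\<^sup>2\<close> up to a constant.  The true rate is about \<open>1 / (2 q\<^sup>2)\<close>, twice the one asserted.
\<close>

lemma large_slow_root:
  assumes root: "mode_poly a q z = 0" and q: "100 \<le> \<bar>q\<bar>" and r: "\<bar>q\<bar> / 2 \<le> cmod z"
  shows "cmod (z\<^sup>2 + of_real q ^ 2) \<le> 2" and "cmod z \<le> 2 * \<bar>q\<bar>" and "1 / (4 * q\<^sup>2) \<le> Re z"
proof -
  define r x D where "r = cmod z" and "x = cmod (z - a)" and "D = cmod (z\<^sup>2 + of_real q ^ 2)"
  have q2: "10000 \<le> q\<^sup>2"
    using power_mono[OF q, of 2] by simp
  have r0: "50 \<le> r" using r q unfolding r_def by linarith
  have x: "r - 3 / 2 \<le> x" "x \<le> r + 3 / 2"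
    using norm_diff_a_le norm_diff_a_ge by (simp_all add: r_def x_def)
  have "x * D = r" unfolding x_def r_def D_def by (rule root_moduli(1)[OF root])
  moreover have "r / 2 \<le> x" using x r0 by linarith
  moreover have "0 \<le> D" by (simp add: D_def)
  ultimately have "r / 2 * D \<le> r" using mult_right_mono by metis
  then have "r * D \<le> r * 2" by simp
  then have D: "D \<le> 2" using r0 by simp
  then show "cmod (z\<^sup>2 + of_real q ^ 2) \<le> 2" by (simp add: D_def)
  have "r\<^sup>2 - q\<^sup>2 \<le> D"
    using norm_diff_ineq[of "z\<^sup>2" "of_real q ^ 2"] by (simp add: D_def r_def norm_power)
  then have rq: "r\<^sup>2 \<le> q\<^sup>2 + 2" using D by linarith
  also have "\<dots> \<le> (2 * \<bar>q\<bar>)\<^sup>2" using q2 by (simp add: power_mult_distrib)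
  finally show "cmod z \<le> 2 * \<bar>q\<bar>"
    unfolding r_def by (rule power2_le_imp_le) simp
  have "1 / (1 + (4 * q\<^sup>2 - 1)) \<le> Re z"
  proof (rule root_Re_lower_bound[OF root])
    show "z \<noteq> 0" using r0 by (auto simp: r_def)
    show "0 \<le> 4 * q\<^sup>2 - 1" using q2 by linarith
    have "x \<le> 103 / 100 * r" using x r0 by linarith
    moreover have "0 \<le> x" using x r0 by linarith
    ultimately have "x\<^sup>2 \<le> (103 / 100 * r)\<^sup>2" by (intro power_mono) auto
    then have "(r\<^sup>2 + q\<^sup>2) * x\<^sup>2 \<le> (3 * q\<^sup>2) * (103 / 100 * r)\<^sup>2"
      using rq q2 by (intro mult_mono) auto
    also have "\<dots> = (3 * (103 / 100)\<^sup>2 * q\<^sup>2) * r\<^sup>2"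
      by (simp add: power_mult_distrib power_divide)
    also have "\<dots> \<le> (4 * q\<^sup>2 - 1) * r\<^sup>2"
      using q2 by (intro mult_right_mono) (auto simp: power_divide)
    finally show "((cmod z)\<^sup>2 + q\<^sup>2) * (cmod (z - a))\<^sup>2 \<le> (4 * q\<^sup>2 - 1) * (cmod z)\<^sup>2"
      by (simp add: r_def x_def)
  qed
  then show "1 / (4 * q\<^sup>2) \<le> Re z" by simp
qed

section \<open>Size of a single mode\<close>

text \<open>
  The vectors \<open>w\<close> and \<open>v\<close> give the relative sizes of the components of the slow and of the fast
  eigenvectors.
\<close>

lemma small_mode_bound:
  fixes w v :: "real^3"
  assumes root: "mode_poly a q z = 0" and q: "\<bar>q\<bar> \<le> 1 / 100" and t: "0 \<le> t"
    and w: "w = vector [\<bar>q\<bar>, \<bar>q\<bar>, 1]" and v: "v = vector [1, 1, \<bar>q\<bar>]"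
  shows "exp (- t * Re z) * cmod (mode_adjugate a q z $ i $ j)
    \<le> 17 * (w $ i * w $ j) * exp (- (q\<^sup>2 * t) / 2) + 17 * (v $ i * v $ j) * exp (- t / 8)"
proof -
  define r x where "r = cmod z" and "x = cmod (z - a)"
  have q2: "q\<^sup>2 \<le> 1 / 10000"
    using power_mono[OF q, of 2] by (simp add: power_divide)
  have r0: "0 \<le> r" and x0: "0 \<le> x" by (simp_all add: r_def x_def)
  have D: "cmod (z\<^sup>2 + of_real q ^ 2) \<le> r\<^sup>2 + q\<^sup>2"
    using norm_triangle_ineq[of "z\<^sup>2" "of_real q ^ 2"] by (simp add: r_def norm_power)
  have wv: "\<forall>i. 0 \<le> w $ i" "\<forall>i. 0 \<le> v $ i"
    by (simp_all add: forall_3 w v)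
  consider "r \<le> 1 / 4" | "1 / 4 \<le> r" by linarith
  then show ?thesis
  proof cases
    case 1
    then have r1: "r \<le> 8 / 3 * q\<^sup>2" and Re: "q\<^sup>2 / 2 \<le> Re z"
      using small_slow_root[OF root q] by (simp_all add: r_def)
    have x2: "x \<le> 2" using norm_diff_a_le[of z] 1 by (simp add: x_def r_def)
    have "r * r \<le> 1 * (8 / 3 * q\<^sup>2)" using r1 r0 1 by (intro mult_mono) auto
    then have rr: "r\<^sup>2 \<le> 8 / 3 * q\<^sup>2" by (simp add: power2_eq_square)
    have xr: "x * r \<le> 2 * (8 / 3 * q\<^sup>2)" using r1 r0 x0 x2 by (intro mult_mono) auto
    have qx: "\<bar>q\<bar> * x \<le> \<bar>q\<bar> * 17" using x2 by (intro mult_left_mono) auto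
    have "cmod ((z - a) * z + 1) \<le> x * r + 1"
      using norm_triangle_ineq[of "(z - a) * z" 1] by (simp add: norm_mult x_def r_def)
    then have "cmod ((z - a) * z + 1) \<le> 17" using xr q2 by linarith
    moreover have "r\<^sup>2 + q\<^sup>2 \<le> 17 * q\<^sup>2" "r \<le> 17 * q\<^sup>2" "x * r \<le> 17 * q\<^sup>2"
      using rr r1 xr zero_le_power2[of q] by linarith+
    ultimately have "cmod (mode_adjugate a q z $ i $ j) \<le> 17 * (w $ i * w $ j)"
      using D qx by (intro mode_adjugate_bound) (simp_all add: w r_def x_def power2_eq_square)
    moreover have "t * (q\<^sup>2 / 2) \<le> t * Re z" using Re t by (rule mult_left_mono)
    then have "exp (- t * Re z) \<le> exp (- (q\<^sup>2 * t) / 2)" by (simp add: mult.commute)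
    ultimately have "exp (- t * Re z) * cmod (mode_adjugate a q z $ i $ j)
        \<le> (17 * (w $ i * w $ j)) * exp (- (q\<^sup>2 * t) / 2)"
      by (intro mult_le_mult_commuted) auto
    moreover have "0 \<le> 17 * (v $ i * v $ j) * exp (- t / 8)" using wv by simp
    ultimately show ?thesis by linarith
  next
    case 2
    then have x2: "x \<le> 21 / 10" and Re: "1 / 8 \<le> Re z"
      using small_fast_root[OF root q] by (simp_all add: r_def x_def)
    have "sqrt (1 + q\<^sup>2) \<le> sqrt ((4 / 3)\<^sup>2)"
      using q2 by (intro real_sqrt_le_mono) (simp add: power_divide)
    then have r4: "r \<le> 4" using root_norm_le[OF root] by (simp add: r_def)
    have "r\<^sup>2 \<le> 4\<^sup>2" using r4 r0 by (intro power_mono) auto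
    then have rq: "r\<^sup>2 + q\<^sup>2 \<le> 17" using q2 by simp
    have xr: "x * r \<le> 21 / 10 * 4" using r4 r0 x0 x2 by (intro mult_mono) auto
    have qx: "\<bar>q\<bar> * x \<le> \<bar>q\<bar> * 17" using x2 by (intro mult_left_mono) auto
    have "1 / 4 * cmod ((z - a) * z + 1) \<le> r * cmod ((z - a) * z + 1)"
      using 2 by (intro mult_right_mono) auto
    also have "\<dots> = q\<^sup>2 * x" unfolding r_def x_def by (rule root_moduli(2)[OF root])
    also have "\<dots> \<le> q\<^sup>2 * (21 / 10)" using x2 by (intro mult_left_mono) auto
    finally have "cmod ((z - a) * z + 1) \<le> 17 * q\<^sup>2"
      using zero_le_power2[of q] by linarith
    then have "cmod ((z - a) * z + 1) \<le> 17 * (\<bar>q\<bar> * \<bar>q\<bar>)"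
      by (simp add: power2_eq_square)
    then have "cmod (mode_adjugate a q z $ i $ j) \<le> 17 * (v $ i * v $ j)"
      using D qx rq xr r4 by (intro mode_adjugate_bound) (simp_all add: v r_def x_def mult.commute)
    moreover have "t * (1 / 8) \<le> t * Re z" using Re t by (rule mult_left_mono)
    then have "exp (- t * Re z) \<le> exp (- t / 8)" by simp
    ultimately have "exp (- t * Re z) * cmod (mode_adjugate a q z $ i $ j)
        \<le> (17 * (v $ i * v $ j)) * exp (- t / 8)"
      by (intro mult_le_mult_commuted) auto
    moreover have "0 \<le> 17 * (w $ i * w $ j) * exp (- (q\<^sup>2 * t) / 2)" using wv by simp
    ultimately show ?thesis by linarith
  qed
qed

text \<open>
  Here \<open>w\<close> belongs to the fast and \<open>v\<close> to the slow modes.  The factor \<open>q\<^sup>2\<close> is compensated by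
  the derivative of the cubic, which is at least of the order \<open>q\<^sup>2\<close> at each root.
\<close>

lemma large_mode_bound:
  fixes w v :: "real^3"
  assumes root: "mode_poly a q z = 0" and q: "100 \<le> \<bar>q\<bar>" and t: "0 \<le> t"
    and w: "w = vector [1, 1 / \<bar>q\<bar>\<^sup>2, 1 / \<bar>q\<bar>]" and v: "v = vector [1 / \<bar>q\<bar>, 1, 1]"
  shows "exp (- t * Re z) * cmod (mode_adjugate a q z $ i $ j)
    \<le> 8 * q\<^sup>2 * (w $ i * w $ j) * exp (- t / 2) + 8 * q\<^sup>2 * (v $ i * v $ j) * exp (- t / (4 * q\<^sup>2))"
proof -
  define r x p where "r = cmod z" and "x = cmod (z - a)" and "p = \<bar>q\<bar>"
  have p: "100 \<le> p" and qp: "q\<^sup>2 = p\<^sup>2" using q by (simp_all add: p_def)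
  have p2: "10000 \<le> p\<^sup>2" using power_mono[OF p, of 2] by simp
  have pp: "100 * p \<le> p * p" using p by (intro mult_right_mono) auto
  have r0: "0 \<le> r" and x0: "0 \<le> x" by (simp_all add: r_def x_def)
  have D: "cmod (z\<^sup>2 + of_real q ^ 2) \<le> r\<^sup>2 + p\<^sup>2"
    using norm_triangle_ineq[of "z\<^sup>2" "of_real q ^ 2"] by (simp add: r_def p_def norm_power)
  have wv: "\<forall>i. 0 \<le> w $ i" "\<forall>i. 0 \<le> v $ i"
    by (simp_all add: forall_3 w v)
  consider "r \<le> p / 2" | "p / 2 \<le> r" by linarith
  then show ?thesis
  proof cases
    case 1
    then have r2: "r \<le> 2" and xr: "3 / 4 * (x * p\<^sup>2) \<le> r" and Re: "1 / 2 \<le> Re z"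
      using large_fast_root[OF root q] by (simp_all add: r_def x_def p_def)
    have z0: "0 < r"
      using root p2 norm_a_ge by (auto simp: mode_poly_def r_def p_def)
    have "x * p\<^sup>2 \<le> 3" using xr r2 by linarith
    then have x3: "x \<le> 3 / p\<^sup>2" using p2 by (subst pos_le_divide_eq) auto
    have "r\<^sup>2 \<le> 2\<^sup>2" using r2 r0 by (intro power_mono) auto
    then have b11: "r\<^sup>2 + p\<^sup>2 \<le> 8 * p\<^sup>2" using p2 by simp
    have "x * r \<le> (3 / p\<^sup>2) * 2" using x3 r2 r0 p2 by (intro mult_mono) auto
    then have b22: "x * r \<le> 8 / p\<^sup>2" using p2 by (simp add: divide_right_mono order_trans)
    have "p * x \<le> p * (3 / p\<^sup>2)" using x3 p by (intro mult_left_mono) auto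
    then have b23: "p * x \<le> 8 / p" using p by (simp add: power2_eq_square divide_right_mono order_trans)
    have "r * cmod ((z - a) * z + 1) = q\<^sup>2 * x"
      unfolding r_def x_def by (rule root_moduli(2)[OF root])
    also have "\<dots> \<le> r * 8" using xr r0 unfolding qp mult.commute[of "p\<^sup>2"] by linarith
    finally have b33: "cmod ((z - a) * z + 1) \<le> 8" using z0 by simp
    have "cmod (mode_adjugate a q z $ i $ j) \<le> (8 * p\<^sup>2) * (w $ i * w $ j)"
      using D b11 r2 b22 b23 b33 p
      by (intro mode_adjugate_bound) (simp_all add: w r_def x_def p_def[symmetric] power2_eq_square)
    moreover have "t * (1 / 2) \<le> t * Re z" using Re t by (rule mult_left_mono)
    then have "exp (- t * Re z) \<le> exp (- t / 2)" by simp
    ultimately have "exp (- t * Re z) * cmod (mode_adjugate a q z $ i $ j)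
        \<le> (8 * p\<^sup>2 * (w $ i * w $ j)) * exp (- t / 2)"
      by (intro mult_le_mult_commuted) auto
    moreover have "0 \<le> 8 * q\<^sup>2 * (v $ i * v $ j) * exp (- t / (4 * q\<^sup>2))" using wv by simp
    ultimately show ?thesis unfolding qp by linarith
  next
    case 2
    then have D2: "cmod (z\<^sup>2 + of_real q ^ 2) \<le> 2" and r2: "r \<le> 2 * p" and Re: "1 / (4 * q\<^sup>2) \<le> Re z"
      using large_slow_root[OF root q] by (simp_all add: r_def x_def p_def)
    have x2: "x \<le> 203 / 100 * p"
      using norm_diff_a_le[of z] r2 p by (simp add: x_def r_def)
    have "x * r \<le> (203 / 100 * p) * (2 * p)" using x2 x0 r2 r0 p by (intro mult_mono) auto
    then have xr: "x * r \<le> 406 / 100 * (p * p)" by simp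
    then have b22: "x * r \<le> 8 * (p * p)" using pp p by linarith
    have "p * x \<le> p * (203 / 100 * p)" using x2 p by (intro mult_left_mono) auto
    then have b23: "p * x \<le> 8 * (p * p)" using p pp by simp
    have "cmod ((z - a) * z + 1) \<le> x * r + 1"
      using norm_triangle_ineq[of "(z - a) * z" 1] by (simp add: norm_mult x_def r_def)
    then have b33: "cmod ((z - a) * z + 1) \<le> 8 * (p * p)" using xr pp p by linarith
    have "cmod (mode_adjugate a q z $ i $ j) \<le> (8 * p\<^sup>2) * (v $ i * v $ j)"
      using D2 r2 b22 b23 b33 p pp
      by (intro mode_adjugate_bound) (simp_all add: v r_def x_def p_def[symmetric] power2_eq_square)
    moreover have "t * (1 / (4 * q\<^sup>2)) \<le> t * Re z" using Re t by (rule mult_left_mono)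
    then have "exp (- t * Re z) \<le> exp (- t / (4 * q\<^sup>2))" by simp
    ultimately have "exp (- t * Re z) * cmod (mode_adjugate a q z $ i $ j)
        \<le> (8 * p\<^sup>2 * (v $ i * v $ j)) * exp (- t / (4 * q\<^sup>2))"
      by (intro mult_le_mult_commuted) auto
    moreover have "0 \<le> 8 * q\<^sup>2 * (w $ i * w $ j) * exp (- t / 2)" using wv by simp
    ultimately show ?thesis unfolding qp by linarith
  qed
qed

text \<open>
  \<open>N\<close> bounds \<open>|q|\<close>, \<open>|z|\<close> and \<open>|z - a|\<close>.  The third equation of \<open>root_moduli\<close> bounds \<open>|z|\<close> from
  below by \<open>\<epsilon>\<^sup>2 / (2 N\<^sup>2)\<close>, and \<open>8 N\<^sup>8 / \<epsilon>\<^sup>4\<close> is the resulting bound on the ratio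
  \<open>(|z|\<^sup>2 + q\<^sup>2) |z - a|\<^sup>2 / |z|\<^sup>2\<close> that fixes the decay rate.
\<close>

lemma middle_mode_bound:
  assumes root: "mode_poly a q z = 0" and q: "\<epsilon> \<le> \<bar>q\<bar>" "\<bar>q\<bar> \<le> R" and t: "0 \<le> t" and \<epsilon>: "0 < \<epsilon>"
    and N: "N = 3 * R + 5" and c: "c = 1 / (1 + 8 * N ^ 8 / \<epsilon> ^ 4)"
  shows "exp (- t * Re z) * cmod (mode_adjugate a q z $ i $ j) \<le> 2 * N\<^sup>2 * exp (- c * t)"
proof -
  define r x M where "r = cmod z" and "x = cmod (z - a)"
    and "M = cmod ((z - a) * z + of_real (1 + q\<^sup>2))"
  have R: "0 < R" using q \<epsilon> by linarith
  have r0: "0 \<le> r" and x0: "0 \<le> x" by (simp_all add: r_def x_def)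
  have "1 + q\<^sup>2 \<le> (1 + \<bar>q\<bar>)\<^sup>2" by (simp add: power2_eq_square algebra_simps)
  then have "sqrt (1 + q\<^sup>2) \<le> 1 + \<bar>q\<bar>" by (intro real_le_lsqrt) auto
  then have r1: "r \<le> N - 2" using root_norm_le[OF root] q by (simp add: r_def N)
  then have x1: "x \<le> N" using norm_diff_a_le[of z] by (simp add: x_def r_def)
  have N5: "5 \<le> N" using R by (simp add: N)
  have qN: "\<bar>q\<bar> \<le> N" using q R by (simp add: N)
  have q2: "q\<^sup>2 \<le> N\<^sup>2" using power_mono[OF qN, of 2] by simp
  have rN: "r \<le> N" using r1 by simp
  have r2: "r\<^sup>2 \<le> N\<^sup>2" using rN r0 by (intro power_mono) auto
  have x2: "x\<^sup>2 \<le> N\<^sup>2" using x1 x0 by (intro power_mono) auto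
  have NN: "5 * N \<le> N\<^sup>2" using N5 by (simp add: power2_eq_square mult_right_mono)
  have "x * r \<le> N * (N - 2)" using x1 r1 x0 r0 N5 by (intro mult_mono) auto
  then have xr: "x * r + 1 \<le> N\<^sup>2" using N5 by (simp add: power2_eq_square algebra_simps)
  have qx: "\<bar>q\<bar> * x \<le> N\<^sup>2"
    using qN x1 x0 N5 by (auto simp: power2_eq_square intro!: mult_mono)
  have D: "cmod (z\<^sup>2 + of_real q ^ 2) \<le> r\<^sup>2 + q\<^sup>2"
    using norm_triangle_ineq[of "z\<^sup>2" "of_real q ^ 2"] by (simp add: r_def norm_power)
  have b33: "cmod ((z - a) * z + 1) \<le> x * r + 1"
    using norm_triangle_ineq[of "(z - a) * z" 1] by (simp add: norm_mult x_def r_def)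
  have n: "cmod ((z - a) * z) = x * r" "cmod (of_real (1 + q\<^sup>2)) = 1 + q\<^sup>2"
    by (simp_all only: norm_mult norm_of_real x_def r_def) simp
  have "M \<le> x * r + (1 + q\<^sup>2)"
    using norm_triangle_ineq[of "(z - a) * z" "of_real (1 + q\<^sup>2)"]
    unfolding M_def n by simp
  then have M: "M \<le> 2 * N\<^sup>2" using xr q2 by linarith
  have D': "cmod (z\<^sup>2 + of_real q ^ 2) \<le> 2 * N\<^sup>2" and rN': "r \<le> 2 * N\<^sup>2" "\<bar>q\<bar> \<le> 2 * N\<^sup>2"
    and xr': "x * r \<le> 2 * N\<^sup>2" and qx': "\<bar>q\<bar> * x \<le> 2 * N\<^sup>2"
    and b33': "cmod ((z - a) * z + 1) \<le> 2 * N\<^sup>2"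
    using D r2 q2 rN qN xr qx b33 NN N5 by linarith+
  define w :: "real^3" where "w = 1"
  have "cmod (mode_adjugate a q z $ i $ j) \<le> 2 * N\<^sup>2 * (w $ i * w $ j)"
    using D' qN xr' qx' b33' rN'
    by (intro mode_adjugate_bound) (simp_all add: w_def r_def x_def)
  then have "cmod (mode_adjugate a q z $ i $ j) \<le> 2 * N\<^sup>2" by (simp add: w_def)
  moreover have "c \<le> Re z"
    unfolding c
  proof (rule root_Re_lower_bound[OF root])
    have "\<epsilon>\<^sup>2 \<le> q\<^sup>2" using power_mono[OF q(1), of 2] \<epsilon> by simp
    also have "\<dots> \<le> cmod a * q\<^sup>2"
      using norm_a_ge mult_right_mono[of 1 "cmod a" "q\<^sup>2"] by simp
    also have "\<dots> = r * M"
      using root_moduli(3)[OF root] by (simp only: r_def M_def)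
    also have "\<dots> \<le> r * (2 * N\<^sup>2)" using M r0 by (rule mult_left_mono)
    finally have le: "\<epsilon>\<^sup>2 \<le> 2 * N\<^sup>2 * r" by (simp only: mult_ac)
    then show "z \<noteq> 0" using \<epsilon> by (auto simp: r_def)
    show "0 \<le> 8 * N ^ 8 / \<epsilon> ^ 4" using N5 \<epsilon> by simp
    have "(\<epsilon>\<^sup>2)\<^sup>2 \<le> (2 * N\<^sup>2 * r)\<^sup>2" using le by (intro power_mono) auto
    then have "\<epsilon> ^ 4 \<le> 4 * N ^ 4 * r\<^sup>2"
      by (simp add: power_mult_distrib flip: power_mult)
    then have "2 * N ^ 4 * \<epsilon> ^ 4 \<le> 2 * N ^ 4 * (4 * N ^ 4 * r\<^sup>2)"
      using N5 by (intro mult_left_mono) auto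
    also have "\<dots> = 8 * N ^ 8 * r\<^sup>2" by (simp add: algebra_simps flip: power_add)
    finally have "2 * N ^ 4 \<le> 8 * N ^ 8 / \<epsilon> ^ 4 * r\<^sup>2"
      using \<epsilon> by (simp add: pos_le_divide_eq)
    moreover have "(r\<^sup>2 + q\<^sup>2) * x\<^sup>2 \<le> (2 * N\<^sup>2) * N\<^sup>2"
      using r2 q2 x2 by (intro mult_mono) auto
    moreover have "(2 * N\<^sup>2) * N\<^sup>2 = 2 * N ^ 4" by (simp flip: power_add)
    ultimately show "((cmod z)\<^sup>2 + q\<^sup>2) * (cmod (z - a))\<^sup>2 \<le> 8 * N ^ 8 / \<epsilon> ^ 4 * (cmod z)\<^sup>2"
      unfolding r_def x_def by linarith
  qed
  then have "t * c \<le> t * Re z" using t by (rule mult_left_mono)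
  then have "exp (- t * Re z) \<le> exp (- c * t)" by (simp add: mult.commute)
  ultimately show ?thesis by (intro mult_le_mult_commuted) auto
qed

end

section \<open>The matrix exponential as a sum over modes\<close>

text \<open>
  A resolution of the identity into matrices whose columns are eigenvectors diagonalises every
  power of \<open>A\<close>, and so its exponential series.
\<close>

lemma mat_power_spectral:
  fixes A :: "complex^'n^'n" and P :: "'b \<Rightarrow> complex^'n^'n"
  assumes eigen: "\<And>m i j. m \<in> J \<Longrightarrow> (A ** P m) $ i $ j = \<mu> m * P m $ i $ j"
    and identity: "\<And>i j. (\<Sum>m\<in>J. P m $ i $ j) = mat 1 $ i $ j"
  shows "mat_power A n $ i $ j = (\<Sum>m\<in>J. \<mu> m ^ n * P m $ i $ j)"
proof (induction n arbitrary: i j)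
  case 0
  then show ?case by (simp add: identity)
next
  case (Suc n)
  have "mat_power A (Suc n) $ i $ j = (\<Sum>l\<in>UNIV. A $ i $ l * (\<Sum>m\<in>J. \<mu> m ^ n * P m $ l $ j))"
    by (simp add: matrix_matrix_mult_def Suc.IH)
  also have "\<dots> = (\<Sum>l\<in>UNIV. \<Sum>m\<in>J. \<mu> m ^ n * (A $ i $ l * P m $ l $ j))"
    by (simp add: sum_distrib_left mult_ac)
  also have "\<dots> = (\<Sum>m\<in>J. \<mu> m ^ n * (A ** P m) $ i $ j)"
    by (subst sum.swap) (simp add: matrix_matrix_mult_def sum_distrib_left)
  also have "\<dots> = (\<Sum>m\<in>J. \<mu> m ^ Suc n * P m $ i $ j)"
    by (intro sum.cong) (simp_all add: eigen mult_ac)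
  finally show ?case .
qed

lemma mat_exp_spectral:
  fixes A :: "complex^'n^'n" and P :: "'b \<Rightarrow> complex^'n^'n"
  assumes "\<And>m i j. m \<in> J \<Longrightarrow> (A ** P m) $ i $ j = \<mu> m * P m $ i $ j"
    and "\<And>i j. (\<Sum>m\<in>J. P m $ i $ j) = mat 1 $ i $ j"
  shows "mat_exp A $ i $ j = (\<Sum>m\<in>J. exp (\<mu> m) * P m $ i $ j)"
proof -
  have "(\<lambda>n. ((1 / fact n) *\<^sub>R mat_power A n) $ i $ j) sums (mat_exp A $ i $ j)"
    by (intro bounded_linear.sums[OF bounded_linear_vec_nth] mat_exp_sums)
  moreover have "((1 / fact n) *\<^sub>R mat_power A n) $ i $ j = (\<Sum>m\<in>J. (\<mu> m ^ n /\<^sub>R fact n) * P m $ i $ j)" for n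
    by (simp add: mat_power_spectral[OF assms] scaleR_sum_right divide_inverse_commute)
  moreover have "(\<lambda>n. \<Sum>m\<in>J. (\<mu> m ^ n /\<^sub>R fact n) * P m $ i $ j) sums (\<Sum>m\<in>J. exp (\<mu> m) * P m $ i $ j)"
    by (intro sums_sum sums_mult2 exp_converges)
  ultimately show ?thesis by (simp add: sums_unique2)
qed

definition kronecker :: "complex^3^3 \<Rightarrow> complex^2^2 \<Rightarrow> complex^(3 \<times> 2)^(3 \<times> 2)" where
  "kronecker M N = (\<chi> i j. M $ fst i $ fst j * N $ snd i $ snd j)"

text \<open>
  The projection \<open>(1 - \<i> s O1) / 2\<close> onto the eigenspace of \<open>O1\<close> for the eigenvalue \<open>\<i> s\<close>, where \<open>s = \<plusminus>1\<close>.
\<close>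

definition circular_projection :: "real \<Rightarrow> complex^2^2" where
  "circular_projection s = vector [
     vector [1 / 2, \<i> * of_real s / 2],
     vector [- \<i> * of_real s / 2, 1 / 2]]"

text \<open>
  On the range of the projection, \<open>O1\<close> acts as multiplication by \<open>\<i> s\<close>, so \<open>\<i> k O1\<close> becomes the real number
  \<open>- k s\<close>; this turns the block matrix into the \<open>3 \<times> 3\<close> matrix of one polarisation.
\<close>

lemma A_r_mult_kronecker:
  assumes "s \<in> {1, -1}"
  shows "A_r k ** kronecker M (circular_projection s)
    = kronecker (mode_matrix (1 - \<i> * of_real s) (k * s) ** M) (circular_projection s)"
proof -
  have sum_pairs: "(\<Sum>l\<in>UNIV. f l) = (\<Sum>p\<in>UNIV. \<Sum>q\<in>UNIV. f (p, q))" for f :: "3 \<times> 2 \<Rightarrow> complex"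
    by (simp add: sum.cartesian_product)
  have "\<forall>p q q'. (A_r k ** kronecker M (circular_projection s)) $ (p, q) $ (p', q')
    = kronecker (mode_matrix (1 - \<i> * of_real s) (k * s) ** M) (circular_projection s) $ (p, q) $ (p', q')" for p'
    using assms unfolding forall_3 forall_2
    by (auto simp: matrix_matrix_mult_def kronecker_def circular_projection_def mode_matrix_def A_r_def
        block_matrix_def O1_def mat_def sum_pairs sum_3 sum_2 algebra_simps)
  then show ?thesis by (simp add: vec_eq_iff split_paired_all)
qed

lemma circular_projection_sum:
  "circular_projection 1 $ i $ j + circular_projection (- 1) $ i $ j = mat 1 $ i $ j"
proof -
  have "\<forall>i j. circular_projection 1 $ i $ j + circular_projection (- 1) $ i $ j = mat 1 $ i $ j"
    unfolding forall_2 by (simp add: circular_projection_def mat_def)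
  then show ?thesis by blast
qed

lemma norm_circular_projection:
  assumes "s \<in> {1, -1}"
  shows "cmod (circular_projection s $ i $ j) = 1 / 2"
proof -
  have "\<forall>i j. cmod (circular_projection s $ i $ j) = 1 / 2"
    using assms unfolding forall_2 by (auto simp: circular_projection_def norm_mult norm_divide)
  then show ?thesis by blast
qed

lemma circular_mode_rotation:
  assumes "s \<in> {1, -1}"
  shows "circular_mode (1 - \<i> * of_real s)"
  using assms by unfold_locales auto

definition mode_projection :: "complex \<Rightarrow> real \<Rightarrow> complex \<Rightarrow> complex^3^3" where
  "mode_projection a q z = (\<chi> i j. mode_adjugate a q z $ i $ j / mode_poly_deriv a q z)"

lemma mode_matrix_mult_projection:
  assumes "mode_poly a q z = 0"
  shows "(mode_matrix a q ** mode_projection a q z) $ i $ j = z * mode_projection a q z $ i $ j"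
proof -
  have "(mode_matrix a q ** mode_projection a q z) $ i $ j
    = (mode_matrix a q ** mode_adjugate a q z) $ i $ j / mode_poly_deriv a q z"
    by (simp add: matrix_matrix_mult_def mode_projection_def sum_divide_distrib)
  then show ?thesis
    by (simp add: mode_matrix_mult_adjugate[OF assms] mode_projection_def)
qed

lemma G_e_spectral:
  "G_e t k $ i $ j = (\<Sum>s\<in>{1, -1}. \<Sum>z | mode_poly (1 - \<i> * of_real s) (k * s) z = 0.
    exp (- (of_real t * z)) * (mode_projection (1 - \<i> * of_real s) (k * s) z $ fst i $ fst j
      * circular_projection s $ snd i $ snd j))"
proof -
  define a where "a s = 1 - \<i> * complex_of_real s" for s
  define Z where "Z s = {z. mode_poly (a s) (k * s) z = 0}" for s
  define P where "P = (\<lambda>(s, z). kronecker (mode_projection (a s) (k * s) z) (circular_projection s))"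
  define J where "J = Sigma {1, -1 :: real} Z"
  have mode: "circular_mode (a s)" if "s \<in> {1, -1}" for s
    unfolding a_def using that by (rule circular_mode_rotation)
  have fin: "finite (Z s)" if "s \<in> {1, -1}" for s
    unfolding Z_def by (rule circular_mode.finite_roots[OF mode[OF that]])
  have double: "(\<Sum>m\<in>J. f m) = (\<Sum>s\<in>{1, -1}. \<Sum>z\<in>Z s. f (s, z))" for f :: "real \<times> complex \<Rightarrow> complex"
    unfolding J_def using fin by (subst sum.Sigma) auto
  have "G_e t k $ i $ j = (\<Sum>m\<in>J. exp (- (of_real t * snd m)) * P m $ i $ j)"
    unfolding G_e_def
  proof (rule mat_exp_spectral)
    fix m i j
    assume "m \<in> J"
    then obtain s z where m: "m = (s, z)" and s: "s \<in> {1, -1}" and z: "mode_poly (a s) (k * s) z = 0"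
      by (auto simp: J_def Z_def)
    have "(A_r k ** P m) $ i $ j = z * P m $ i $ j"
      unfolding m P_def prod.case a_def A_r_mult_kronecker[OF s]
      using mode_matrix_mult_projection[OF z] by (simp add: kronecker_def a_def)
    moreover have "(- (t *\<^sub>R A_r k) ** P m) $ i $ j = - (of_real t * (A_r k ** P m) $ i $ j)"
      by (simp add: matrix_matrix_mult_def sum_negf sum_distrib_left scaleR_conv_of_real[of _ "_ :: complex"] mult_ac)
    ultimately show "(- (t *\<^sub>R A_r k) ** P m) $ i $ j = - (of_real t * snd m) * P m $ i $ j"
      by (simp add: m)
  next
    fix i j
    have "(\<Sum>m\<in>J. P m $ i $ j) = (\<Sum>s\<in>{1, -1}. (\<Sum>z\<in>Z s. mode_projection (a s) (k * s) z $ fst i $ fst j)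
        * circular_projection s $ snd i $ snd j)"
      unfolding double by (simp add: P_def kronecker_def sum_distrib_right)
    also have "\<dots> = (\<Sum>s\<in>{1, -1}. mat 1 $ fst i $ fst j * circular_projection s $ snd i $ snd j)"
      using circular_mode.mode_resolution_of_identity[OF mode]
      by (intro sum.cong refl) (simp add: Z_def mode_projection_def)
    also have "\<dots> = mat 1 $ fst i $ fst j * mat 1 $ snd i $ snd j"
      by (simp add: circular_projection_sum flip: distrib_left)
    also have "\<dots> = mat 1 $ i $ j"
      by (auto simp: mat_def prod_eq_iff)
    finally show "(\<Sum>m\<in>J. P m $ i $ j) = mat 1 $ i $ j" .
  qed
  then show ?thesis
    unfolding double by (simp only: P_def kronecker_def Z_def a_def) simp
qed

text \<open>
  There are two polarisations with three roots each.  Each term carries a factor \<open>1 / 2\<close> from the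
  circular projection and at most \<open>6 / (1 + k\<^sup>2)\<close> from the separation of the roots.
\<close>

lemma G_e_entry_bound:
  assumes "\<And>s z. s \<in> {1, -1} \<Longrightarrow> mode_poly (1 - \<i> * of_real s) (k * s) z = 0 \<Longrightarrow>
    exp (- t * Re z) * cmod (mode_adjugate (1 - \<i> * of_real s) (k * s) z $ fst i $ fst j) \<le> B * (1 + k\<^sup>2)"
  shows "cmod (G_e t k $ i $ j) \<le> 18 * B"
proof -
  have "cmod (G_e t k $ i $ j) \<le> (\<Sum>s\<in>{1, -1 :: real}. of_nat 3 * (3 * B))"
    unfolding G_e_spectral
  proof (intro sum_norm_le)
    fix s :: real
    assume s: "s \<in> {1, -1}"
    define a where "a = 1 - \<i> * complex_of_real s"
    interpret circular_mode a
      unfolding a_def using s by (rule circular_mode_rotation)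
    have ks: "(k * s)\<^sup>2 = k\<^sup>2" using s by (auto simp: power_mult_distrib)
    show "cmod (\<Sum>z | mode_poly (1 - \<i> * of_real s) (k * s) z = 0.
      exp (- (of_real t * z)) * (mode_projection (1 - \<i> * of_real s) (k * s) z $ fst i $ fst j
        * circular_projection s $ snd i $ snd j)) \<le> of_nat 3 * (3 * B)"
      unfolding a_def[symmetric] card_roots[of "k * s", symmetric]
    proof (rule order_trans[OF norm_sum], rule sum_bounded_above)
      fix z
      assume "z \<in> {z. mode_poly a (k * s) z = 0}"
      then have z: "mode_poly a (k * s) z = 0" by simp
      define d where "d = cmod (mode_poly_deriv a (k * s) z)"
      have pos: "0 < 1 + k\<^sup>2" by (simp add: add_pos_nonneg)
      have d: "(1 + k\<^sup>2) / 6 \<le> d"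
        using mode_poly_deriv_lower_bound[OF z] by (simp add: d_def ks)
      have le: "exp (- t * Re z) * cmod (mode_adjugate a (k * s) z $ fst i $ fst j) \<le> B * (1 + k\<^sup>2)"
        using assms[OF s] z by (simp add: a_def)
      have "0 \<le> B * (1 + k\<^sup>2)" using le by (rule order_trans[rotated]) simp
      then have B: "0 \<le> B" using pos by (simp add: zero_le_mult_iff)
      have "cmod (exp (- (of_real t * z)) * (mode_projection a (k * s) z $ fst i $ fst j
          * circular_projection s $ snd i $ snd j))
        = exp (- t * Re z) * cmod (mode_adjugate a (k * s) z $ fst i $ fst j) / (2 * d)"
        by (simp add: norm_mult norm_divide norm_exp_eq_Re norm_circular_projection[OF s]
            mode_projection_def d_def)
      also have "\<dots> \<le> B * (1 + k\<^sup>2) / (2 * ((1 + k\<^sup>2) / 6))"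
        using le d pos B by (intro frac_le) auto
      also have "\<dots> = 3 * B" using pos by (simp add: field_simps)
      finally show "cmod (exp (- (of_real t * z)) * (mode_projection a (k * s) z $ fst i $ fst j
          * circular_projection s $ snd i $ snd j)) \<le> 3 * B" .
    qed
  qed
  then show ?thesis by simp
qed

section \<open>The three frequency ranges\<close>

lemma block_matrix_rank_one:
  fixes w :: "real^3"
  assumes "\<forall>p p'. M $ p $ p' = (w $ p * w $ p') *\<^sub>R I1"
  shows "block_matrix M $ i $ j = w $ fst i * w $ fst j"
proof -
  have "\<forall>q q'. I1 $ q $ q' = 1" unfolding forall_2 by (simp add: I1_def)
  then show ?thesis using assms by (simp add: block_matrix_def)
qed

lemma block_bound:
  fixes w v :: "real^3"
  assumes entry: "\<And>i j. cmod (G $ i $ j) \<le> c * (w $ fst i * w $ fst j) + d * (v $ fst i * v $ fst j)"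
    and M: "\<forall>p p'. M $ p $ p' = (w $ p * w $ p') *\<^sub>R I1"
    and N: "\<forall>p p'. N $ p $ p' = (v $ p * v $ p') *\<^sub>R I1"
  shows "map_matrix cmod G \<le> c *\<^sub>R block_matrix M + d *\<^sub>R block_matrix N"
  using entry by (simp add: less_eq_vec_def block_matrix_rank_one[OF M] block_matrix_rank_one[OF N])

lemma small_frequency_bound:
  assumes k: "\<bar>k\<bar> < 1 / 100" and t: "0 \<le> t" and C: "306 \<le> C"
    and w: "w = vector [\<bar>k\<bar>, \<bar>k\<bar>, 1]" and v: "v = vector [1, 1, \<bar>k\<bar>]"
  shows "cmod (G_e t k $ i $ j) \<le> (C * exp (- (k\<^sup>2 * t) / 2)) * (w $ fst i * w $ fst j)
    + (C * exp (- t / 8)) * (v $ fst i * v $ fst j)"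
proof -
  have wv: "\<forall>i. 0 \<le> w $ i" "\<forall>i. 0 \<le> v $ i"
    by (simp_all add: forall_3 w v)
  define X where "X = w $ fst i * w $ fst j * exp (- (k\<^sup>2 * t) / 2) + v $ fst i * v $ fst j * exp (- t / 8)"
  have X: "0 \<le> X" using wv by (simp add: X_def)
  have "cmod (G_e t k $ i $ j) \<le> 18 * (17 * X)"
  proof (rule G_e_entry_bound)
    fix s z
    assume s: "s \<in> {1, -1 :: real}" and z: "mode_poly (1 - \<i> * of_real s) (k * s) z = 0"
    have ks: "\<bar>k * s\<bar> = \<bar>k\<bar>" "(k * s)\<^sup>2 = k\<^sup>2" using s by (auto simp: power_mult_distrib)
    have "exp (- t * Re z) * cmod (mode_adjugate (1 - \<i> * of_real s) (k * s) z $ fst i $ fst j)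
      \<le> 17 * (w $ fst i * w $ fst j) * exp (- (k\<^sup>2 * t) / 2) + 17 * (v $ fst i * v $ fst j) * exp (- t / 8)"
      using circular_mode.small_mode_bound[OF circular_mode_rotation[OF s] z _ t] k
      unfolding ks w v by simp
    also have "\<dots> = (17 * X) * 1" by (simp add: X_def algebra_simps)
    also have "\<dots> \<le> (17 * X) * (1 + k\<^sup>2)" using X by (intro mult_left_mono) auto
    finally show "exp (- t * Re z) * cmod (mode_adjugate (1 - \<i> * of_real s) (k * s) z $ fst i $ fst j)
      \<le> 17 * X * (1 + k\<^sup>2)" .
  qed
  also have "\<dots> \<le> C * X" using mult_right_mono[OF C X] by simp
  finally show ?thesis by (simp add: X_def algebra_simps)
qed

lemma large_frequency_bound:
  assumes k: "100 < \<bar>k\<bar>" and t: "0 \<le> t" and C: "306 \<le> C"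
    and w: "w = vector [1, 1 / \<bar>k\<bar>\<^sup>2, 1 / \<bar>k\<bar>]" and v: "v = vector [1 / \<bar>k\<bar>, 1, 1]"
  shows "cmod (G_e t k $ i $ j) \<le> (C * exp (- t / 2)) * (w $ fst i * w $ fst j)
    + (C * exp (- t / (4 * k\<^sup>2))) * (v $ fst i * v $ fst j)"
proof -
  have wv: "\<forall>i. 0 \<le> w $ i" "\<forall>i. 0 \<le> v $ i"
    by (simp_all add: forall_3 w v)
  define X where "X = w $ fst i * w $ fst j * exp (- t / 2) + v $ fst i * v $ fst j * exp (- t / (4 * k\<^sup>2))"
  have X: "0 \<le> X" using wv by (simp add: X_def)
  have "cmod (G_e t k $ i $ j) \<le> 18 * (8 * X)"
  proof (rule G_e_entry_bound)
    fix s z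
    assume s: "s \<in> {1, -1 :: real}" and z: "mode_poly (1 - \<i> * of_real s) (k * s) z = 0"
    have ks: "\<bar>k * s\<bar> = \<bar>k\<bar>" "(k * s)\<^sup>2 = k\<^sup>2" using s by (auto simp: power_mult_distrib)
    have "exp (- t * Re z) * cmod (mode_adjugate (1 - \<i> * of_real s) (k * s) z $ fst i $ fst j)
      \<le> 8 * k\<^sup>2 * (w $ fst i * w $ fst j) * exp (- t / 2)
        + 8 * k\<^sup>2 * (v $ fst i * v $ fst j) * exp (- t / (4 * k\<^sup>2))"
      using circular_mode.large_mode_bound[OF circular_mode_rotation[OF s] z _ t] k
      unfolding ks w v by simp
    also have "\<dots> = (8 * X) * k\<^sup>2" by (simp add: X_def algebra_simps)
    also have "\<dots> \<le> (8 * X) * (1 + k\<^sup>2)" using X by (intro mult_left_mono) auto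
    finally show "exp (- t * Re z) * cmod (mode_adjugate (1 - \<i> * of_real s) (k * s) z $ fst i $ fst j)
      \<le> 8 * X * (1 + k\<^sup>2)" .
  qed
  also have "\<dots> \<le> C * X" using mult_right_mono[OF C X] X by linarith
  finally show ?thesis by (simp add: X_def algebra_simps)
qed

lemma middle_frequency_bound:
  assumes k: "\<epsilon> \<le> \<bar>k\<bar>" "\<bar>k\<bar> \<le> R" and t: "0 \<le> t" and \<epsilon>: "0 < \<epsilon>"
    and N: "N = 3 * R + 5" and c: "c = 1 / (1 + 8 * N ^ 8 / \<epsilon> ^ 4)"
    and C: "36 * N\<^sup>2 \<le> C"
  shows "cmod (G_e t k $ i $ j) \<le> C * exp (- c * t)"
proof -
  have "cmod (G_e t k $ i $ j) \<le> 18 * (2 * N\<^sup>2 * exp (- c * t))"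
  proof (rule G_e_entry_bound)
    fix s z
    assume s: "s \<in> {1, -1 :: real}" and z: "mode_poly (1 - \<i> * of_real s) (k * s) z = 0"
    have "\<bar>k * s\<bar> = \<bar>k\<bar>" using s by auto
    then have "exp (- t * Re z) * cmod (mode_adjugate (1 - \<i> * of_real s) (k * s) z $ fst i $ fst j)
      \<le> (2 * N\<^sup>2 * exp (- c * t)) * 1"
      using circular_mode.middle_mode_bound[OF circular_mode_rotation[OF s] z _ _ t \<epsilon> N c] k by simp
    also have "\<dots> \<le> (2 * N\<^sup>2 * exp (- c * t)) * (1 + k\<^sup>2)" by (intro mult_left_mono) auto
    finally show "exp (- t * Re z) * cmod (mode_adjugate (1 - \<i> * of_real s) (k * s) z $ fst i $ fst j)
      \<le> 2 * N\<^sup>2 * exp (- c * t) * (1 + k\<^sup>2)" .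
  qed
  also have "\<dots> \<le> C * exp (- c * t)" using mult_right_mono[OF C, of "exp (- c * t)"] by simp
  finally show ?thesis .
qed

theorem proposition2p9:
  shows "\<exists>\<epsilon>0 R0 :: real. 0 < \<epsilon>0 \<and> \<epsilon>0 < 1 \<and> 1 < R0 \<and>
    (\<forall>\<epsilon> R :: real. 0 < \<epsilon> \<and> \<epsilon> \<le> \<epsilon>0 \<and> R0 \<le> R \<longrightarrow>
      (\<exists>C c :: real. 0 < C \<and> 0 < c \<and>
        (\<forall>t k :: real. 0 \<le> t \<longrightarrow>
          (\<bar>k\<bar> < \<epsilon> \<longrightarrow>
            map_matrix cmod (G_e t k) \<le>
              (C * exp (- (k\<^sup>2 * t) / 2)) *\<^sub>R block_matrix (vector [
                vector [\<bar>k\<bar>\<^sup>2 *\<^sub>R I1, \<bar>k\<bar>\<^sup>2 *\<^sub>R I1, \<bar>k\<bar> *\<^sub>R I1],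
                vector [\<bar>k\<bar>\<^sup>2 *\<^sub>R I1, \<bar>k\<bar>\<^sup>2 *\<^sub>R I1, \<bar>k\<bar> *\<^sub>R I1],
                vector [\<bar>k\<bar> *\<^sub>R I1,  \<bar>k\<bar> *\<^sub>R I1,  I1]])
              + (C * exp (- t / 8)) *\<^sub>R block_matrix (vector [
                vector [I1,         I1,         \<bar>k\<bar> *\<^sub>R I1],
                vector [I1,         I1,         \<bar>k\<bar> *\<^sub>R I1],
                vector [\<bar>k\<bar> *\<^sub>R I1, \<bar>k\<bar> *\<^sub>R I1, \<bar>k\<bar>\<^sup>2 *\<^sub>R I1]])) \<and>
          (R < \<bar>k\<bar> \<longrightarrow>
            map_matrix cmod (G_e t k) \<le>
              (C * exp (- t / 2)) *\<^sub>R block_matrix (vector [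
                vector [I1,                    \<bar>k\<bar> powi (-2) *\<^sub>R I1, \<bar>k\<bar> powi (-1) *\<^sub>R I1],
                vector [\<bar>k\<bar> powi (-2) *\<^sub>R I1, \<bar>k\<bar> powi (-4) *\<^sub>R I1, \<bar>k\<bar> powi (-3) *\<^sub>R I1],
                vector [\<bar>k\<bar> powi (-1) *\<^sub>R I1, \<bar>k\<bar> powi (-3) *\<^sub>R I1, \<bar>k\<bar> powi (-2) *\<^sub>R I1]])
              + (C * exp (- t / (4 * k\<^sup>2))) *\<^sub>R block_matrix (vector [
                vector [\<bar>k\<bar> powi (-2) *\<^sub>R I1, \<bar>k\<bar> powi (-1) *\<^sub>R I1, \<bar>k\<bar> powi (-1) *\<^sub>R I1],
                vector [\<bar>k\<bar> powi (-1) *\<^sub>R I1, I1,                    I1],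
                vector [\<bar>k\<bar> powi (-1) *\<^sub>R I1, I1,                    I1]])) \<and>
          (\<epsilon> \<le> \<bar>k\<bar> \<and> \<bar>k\<bar> \<le> R \<longrightarrow>
            map_matrix cmod (G_e t k) \<le>
              (C * exp (- c * t)) *\<^sub>R block_matrix (vector [
                vector [I1, I1, I1],
                vector [I1, I1, I1],
                vector [I1, I1, I1]])))))"
proof (rule exI[of _ "1 / 100"], rule exI[of _ 100], intro conjI allI impI, goal_cases)
  case (4 \<epsilon> R)
  then have \<epsilon>: "0 < \<epsilon>" "\<epsilon> \<le> 1 / 100" and R: "100 \<le> R" by auto
  define N where "N = 3 * R + 5"
  define c where "c = 1 / (1 + 8 * N ^ 8 / \<epsilon> ^ 4)"
  define C where "C = 306 + 36 * N\<^sup>2"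
  have C: "306 \<le> C" "36 * N\<^sup>2 \<le> C" by (simp_all add: C_def)
  have powi: "\<bar>k\<bar> powi (- 1) = 1 / \<bar>k\<bar>" "\<bar>k\<bar> powi (- 2) = 1 / k\<^sup>2"
    "\<bar>k\<bar> powi (- 3) = 1 / k\<^sup>2 * (1 / \<bar>k\<bar>)" "\<bar>k\<bar> powi (- 4) = 1 / k\<^sup>2 * (1 / k\<^sup>2)" for k :: real
    by (simp_all add: power_int_minus inverse_eq_divide power2_eq_square power3_eq_cube power4_eq_xxxx)
  show ?case
  proof (rule exI[of _ C], rule exI[of _ c], intro conjI allI impI, goal_cases)
    case 1
    then show ?case using C by linarith
  next
    case 2
    then show ?case using \<epsilon> R by (simp add: c_def N_def add_pos_nonneg)
  next
    case (3 t k)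
    show ?case
    proof (rule block_bound)
      show "cmod (G_e t k $ i $ j) \<le>
          (C * exp (- (k\<^sup>2 * t) / 2)) * (vector [\<bar>k\<bar>, \<bar>k\<bar>, 1] $ fst i * vector [\<bar>k\<bar>, \<bar>k\<bar>, 1] $ fst j)
          + (C * exp (- t / 8)) * (vector [1, 1, \<bar>k\<bar>] $ fst i * vector [1, 1, \<bar>k\<bar>] $ fst j)" for i j
        using 3 \<epsilon> C by (intro small_frequency_bound) auto
    qed (simp_all add: forall_3 power2_eq_square)
  next
    case (4 t k)
    show ?case
    proof (rule block_bound)
      show "cmod (G_e t k $ i $ j) \<le>
          (C * exp (- t / 2)) * (vector [1, 1 / \<bar>k\<bar>\<^sup>2, 1 / \<bar>k\<bar>] $ fst i * vector [1, 1 / \<bar>k\<bar>\<^sup>2, 1 / \<bar>k\<bar>] $ fst j)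
          + (C * exp (- t / (4 * k\<^sup>2))) * (vector [1 / \<bar>k\<bar>, 1, 1] $ fst i * vector [1 / \<bar>k\<bar>, 1, 1] $ fst j)" for i j
        using 4 R C by (intro large_frequency_bound) auto
    qed (simp_all only: forall_3 vector_3 powi, simp_all add: power2_eq_square)
  next
    case (5 t k)
    have "cmod (G_e t k $ i $ j) \<le> C * exp (- c * t)" for i j
      using 5 \<epsilon> C by (intro middle_frequency_bound[OF _ _ _ _ N_def c_def]) auto
    moreover have ones: "\<forall>p p'. (vector [vector [I1, I1, I1], vector [I1, I1, I1], vector [I1, I1, I1]] :: real^2^2^3^3) $ p $ p'
        = ((1 :: real^3) $ p * (1 :: real^3) $ p') *\<^sub>R I1"
      by (simp add: forall_3)
    ultimately show ?case
      by (simp add: less_eq_vec_def block_matrix_rank_one[OF ones])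
  qed
qed simp_all

end
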